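(* Let $(R,\mathfrak{m})$ be a Noetherian local ring and $\varphi$ an integral local self-map of $R$. Let $n$ be large enough that the self-map $\overline\varphi_n$ induced by $\varphi$ on $R/\ker\varphi^n$ is injective, and let $p\ge1$ be the smallest integer such that $({}^a\overline\varphi_n)^p$ is the identity on $\operatorname{Min}(R/\ker\varphi^n)$. If $\mathfrak{p}_i\in\operatorname{Spec}(R)$ is such that $\mathfrak{p}_i/\ker\varphi^n\in\operatorname{Min}(R/\ker\varphi^n)$, then $\varphi^p(\mathfrak{p}_i)R\subseteq\mathfrak{p}_i$; denoting by $\overline\varphi_{\mathfrak{p}_i}$ the self-map induced by $\varphi^p$ on $R/\mathfrak{p}_i$, $$h_{\mathrm{alg}}(\varphi,R)=\frac1p\max\{h_{\mathrm{alg}}(\overline\varphi_{\mathfrak{p}_i},R/\mathfrak{p}_i)\mid \mathfrak{p}_i/\ker\varphi^n\in\operatorname{Min}(R/\ker\varphi^n)\}.$$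
   Context: $\varphi$ integral means $R$ is integral over $\varphi(R)$; such a local self-map is of finite length. Since $\varphi(\ker\varphi^n)\subseteq\ker\varphi^n$, $\varphi$ induces a self-map $\overline\varphi_n$ of $R/\ker\varphi^n$, injective for $n$ large; it is integral, and ${}^a\overline\varphi_n$ ($\mathfrak{p}\mapsto\overline\varphi_n^{-1}(\mathfrak{p})$) permutes $\operatorname{Min}(R/\ker\varphi^n)$, the set of minimal primes. A self-map of finite length of a Noetherian local ring $(A,\mathfrak{n})$ is a ring endomorphism $\psi$ with $\psi(\mathfrak{n})\subseteq\mathfrak{n}$ and $\psi(\mathfrak{n})A$ $\mathfrak{n}$-primary. Put $\lambda(\psi^n):=\ell_A(A/\psi^n(\mathfrak{n})A)$; the algebraic entropy is $h_{\mathrm{alg}}(\psi,A):=\lim_{n\to\infty}\frac1n\log\lambda(\psi^n)$ (the limit exists). *)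

theory Defs
  imports Complex_Main "HOL-Algebra.Algebra"
begin

definition noeth_local_ring :: "('a, 'b) ring_scheme \<Rightarrow> bool" where
  "noeth_local_ring R \<longleftrightarrow> cring R \<and> noetherian_ring R \<and> (\<exists>!m. maximalideal m R)"

definition loc_max :: "('a, 'b) ring_scheme \<Rightarrow> 'a set" where
  "loc_max A = (THE m. maximalideal m A)"

definition local_self_map :: "('a, 'b) ring_scheme \<Rightarrow> ('a \<Rightarrow> 'a) \<Rightarrow> bool" where
  "local_self_map R \<phi> \<longleftrightarrow> \<phi> \<in> ring_hom R R \<and> \<phi> ` loc_max R \<subseteq> loc_max R"

definition integral_self_map :: "('a, 'b) ring_scheme \<Rightarrow> ('a \<Rightarrow> 'a) \<Rightarrow> bool" where
  "integral_self_map R \<phi> \<longleftrightarrow>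
     (\<forall>x \<in> carrier R. \<exists>d::nat. \<exists>c::nat \<Rightarrow> 'a. d \<ge> 1 \<and> (\<forall>i<d. c i \<in> \<phi> ` carrier R) \<and>
        x [^]\<^bsub>R\<^esub> d \<oplus>\<^bsub>R\<^esub> finsum R (\<lambda>i. c i \<otimes>\<^bsub>R\<^esub> x [^]\<^bsub>R\<^esub> i) {..<d} = \<zero>\<^bsub>R\<^esub>)"

text \<open>Length of the A-module A/I: maximal length of a strictly increasing chain
  of ideals from I to A (submodules of A/I correspond to ideals containing I).\<close>
definition ideal_chain :: "('a, 'b) ring_scheme \<Rightarrow> 'a set \<Rightarrow> nat \<Rightarrow> bool" where
  "ideal_chain A I k \<longleftrightarrow> (\<exists>J :: nat \<Rightarrow> 'a set. J 0 = I \<and> J k = carrier A \<and>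
      (\<forall>i\<le>k. ideal (J i) A) \<and> (\<forall>i<k. J i \<subset> J (Suc i)))"

definition quot_length :: "('a, 'b) ring_scheme \<Rightarrow> 'a set \<Rightarrow> nat" where
  "quot_length A I = Sup {k. ideal_chain A I k}"

definition lam :: "('a, 'b) ring_scheme \<Rightarrow> ('a \<Rightarrow> 'a) \<Rightarrow> nat \<Rightarrow> nat" where
  "lam A \<psi> n = quot_length A (Idl\<^bsub>A\<^esub> ((\<psi> ^^ n) ` loc_max A))"

definition h_alg :: "('a, 'b) ring_scheme \<Rightarrow> ('a \<Rightarrow> 'a) \<Rightarrow> real" where
  "h_alg A \<psi> = lim (\<lambda>n. ln (real (lam A \<psi> n)) / real n)"

text \<open>Self-map of R/I induced by f (well defined when f(I) is contained in I).\<close>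
definition quot_map :: "('a, 'b) ring_scheme \<Rightarrow> 'a set \<Rightarrow> ('a \<Rightarrow> 'a) \<Rightarrow> 'a set \<Rightarrow> 'a set" where
  "quot_map R I f C = (\<Union>x\<in>C. I +>\<^bsub>R\<^esub> f x)"

definition Min_primes :: "('a, 'b) ring_scheme \<Rightarrow> 'a set set" where
  "Min_primes A = {P. primeideal P A \<and> (\<forall>Q. primeideal Q A \<and> Q \<subseteq> P \<longrightarrow> Q = P)}"

definition spec_map :: "('a, 'b) ring_scheme \<Rightarrow> ('a \<Rightarrow> 'a) \<Rightarrow> 'a set \<Rightarrow> 'a set" where
  "spec_map A f Q = {x \<in> carrier A. f x \<in> Q}"

definition quot_ideal :: "('a, 'b) ring_scheme \<Rightarrow> 'a set \<Rightarrow> 'a set \<Rightarrow> 'a set set" where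
  "quot_ideal R I P = (\<lambda>x. I +>\<^bsub>R\<^esub> x) ` P"

end

theory Submission
  imports Defs
begin

text \<open>Write \<open>\<psi> = \<phi>\<^sup>p\<close> and let \<open>P\<close> range over the finitely many minimal primes over \<open>K\<close>. As \<open>\<phi>\<close> is injective
  modulo \<open>K\<close>, contraction along \<open>\<phi>\<close> permutes them, so \<open>\<psi>(P) \<subseteq> P\<close>. If \<open>b\<close> is the length of \<open>R/\<psi>(m)R\<close>, then
  \<open>R/\<psi>(J)R\<close> has length at most \<open>b\<close> times that of \<open>R/J\<close>; thus lengths are submultiplicative along
  the powers of a self-map, and Fekete's lemma makes \<open>h_alg\<close> a limit, with \<open>h_alg R \<psi> = p * h_alg R \<phi>\<close>.
  The length of \<open>R/(P + \<psi>\<^sup>k(m)R)\<close> is at most that of \<open>R/\<psi>\<^sup>k(m)R\<close>. Conversely, \<open>R/K\<close> has a filtration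
  with factors \<open>R/P'\<close>, each prime \<open>P'\<close> containing some \<open>P\<close>; extending it along \<open>\<psi>\<^sup>n\<close>, which kills \<open>K\<close>,
  gives a filtration of \<open>R\<close> showing that the length of \<open>R/\<psi>\<^bsup>n+k\<^esup>(m)R\<close> is at most a constant times the
  sum over \<open>P\<close> of the lengths of \<open>R/(P + \<psi>\<^sup>k(m)R)\<close>. Hence the growth rates agree.\<close>

section \<open>Growth rates of sequences\<close>

text \<open>All lengths are measured by ideals of \<open>R\<close>: those containing
  \<open>P\<close> stand for the ideals of \<open>R/P\<close>, and a cyclic factor
  \<open>(I + aR)/I\<close> is represented by the colon ideal \<open>(I : a)\<close>, so no modules
  occur. The filtration with factors \<open>R/P'\<close> is therefore an induction that reduces a
  non-prime ideal \<open>I\<close> to \<open>I + aR\<close> and \<open>(I : a)\<close>.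
  \<open>quot_length\<close> is a supremum of naturals and is informative only when the chain
  lengths are bounded, so explicit bounds are propagated before any length is named; integrality
  supplies the first of them, since it leaves \<open>m\<close> as the only prime over
  \<open>\<phi>(m)R\<close>. As \<open>\<psi>\<close> need not be flat, extension along it controls
  lengths from above only. Passing from \<open>R\<close> to \<open>R/K\<close> loses information
  that extension along \<open>\<psi>^n\<close> recovers, at the price of the factor
  \<open>\<lambda>(\<psi>^n)\<close>. This factor and the number of filtration steps are independent
  of \<open>k\<close>, hence disappear after taking logarithms and dividing by
  \<open>k\<close>.\<close>

lemma subadditive_limit_exists:
  fixes u :: "nat \<Rightarrow> real"
  assumes nonneg: "\<And>n. 0 \<le> u n" and sub: "\<And>i j. u (i + j) \<le> u i + u j"
  shows "\<exists>l. (\<lambda>n. u n / real n) \<longlonglongrightarrow> l"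
proof -
  \<comment> \<open>The limit in Fekete's lemma is the infimum of the quotients. Division with
    remainder by an \<open>m\<close> whose quotient is nearly minimal bounds all later
    quotients.\<close>
  define l where "l = (INF n\<in>{1..}. u n / real n)"
  have bdd: "bdd_below ((\<lambda>n. u n / real n) ` {1..})"
    by (rule bdd_belowI[of _ 0]) (use nonneg in auto)
  have lower: "l \<le> u n / real n" if "n \<ge> 1" for n
    unfolding l_def by (rule cINF_lower[OF bdd]) (use that in auto)
  have mult: "u (q * m + r) \<le> real q * u m + u r" for q m r
  proof (induction q)
    case (Suc q)
    have "u (Suc q * m + r) \<le> u m + u (q * m + r)"
      using sub[of m "q * m + r"] by (simp add: algebra_simps)
    then show ?case using Suc by (simp add: algebra_simps)
  qed simp
  have "(\<lambda>n. u n / real n) \<longlonglongrightarrow> l"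
  proof (rule LIMSEQ_I)
    fix e :: real assume e: "0 < e"
    have "(INF n\<in>{1..}. u n / real n) < l + e / 2" using e by (simp add: l_def)
    then obtain m where m: "m \<ge> 1" "u m / real m < l + e / 2"
      by (subst (asm) cINF_less_iff[OF _ bdd]) auto
    \<comment> \<open>\<open>M\<close> dominates \<open>u r\<close> for every possible remainder
      \<open>r\<close> at once, so the error is \<open>M / n\<close>.\<close>
    define M where "M = (\<Sum>r<m. u r)"
    have M: "u r \<le> M" if "r < m" for r
      unfolding M_def by (rule member_le_sum) (use that nonneg in auto)
    have "M \<ge> 0" unfolding M_def by (simp add: sum_nonneg nonneg)
    obtain N :: nat where N: "real N > 2 * M / e" using reals_Archimedean2 by blast
    show "\<exists>no. \<forall>n\<ge>no. norm (u n / real n - l) < e"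
    proof (intro exI[of _ "Suc N"] allI impI)
      fix n assume n: "n \<ge> Suc N"
      then have n0: "real n > 0" by simp
      have "real (n div m) * real m \<le> real n"
        by (metis div_times_less_eq_dividend of_nat_le_iff of_nat_mult)
      then have quot: "real (n div m) \<le> real n / real m" using m by (simp add: field_simps)
      have "u n \<le> real (n div m) * u m + u (n mod m)"
        using mult[of "n div m" m "n mod m"] by simp
      also have "\<dots> \<le> real n / real m * u m + M"
        using m M[of "n mod m"] quot nonneg[of m]
        by (intro add_mono mult_right_mono) auto
      finally have "u n / real n \<le> u m / real m + M / real n"
        using n0 m by (simp add: field_simps)
      moreover have "M / real n < e / 2"
      proof -
        have "2 * M / e < real n" using N n by linarith
        then show ?thesis using e n0 by (simp add: field_simps)
      qed
      ultimately have "u n / real n < l + e" using m by linarith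
      then show "norm (u n / real n - l) < e" using lower[of n] n by simp
    qed
  qed
  then show ?thesis by blast
qed

text \<open>Logarithms turn submultiplicativity into subadditivity, and \<open>1 \<le> f n\<close>
  keeps them nonnegative. The conclusion is phrased with \<open>lim\<close> because
  \<open>h_alg\<close> is defined by it and would otherwise be an unspecified value.\<close>

lemma submultiplicative_growth_limit:
  fixes f :: "nat \<Rightarrow> nat"
  assumes pos: "\<And>n. 1 \<le> f n" and sub: "\<And>i j. f (i + j) \<le> f i * f j"
  shows "(\<lambda>n. ln (real (f n)) / real n) \<longlonglongrightarrow> lim (\<lambda>n. ln (real (f n)) / real n)"
proof -
  have "\<exists>l. (\<lambda>n. ln (real (f n)) / real n) \<longlonglongrightarrow> l"
  proof (rule subadditive_limit_exists)
    show "0 \<le> ln (real (f n))" for n using pos[of n] by simp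
    show "ln (real (f (i + j))) \<le> ln (real (f i)) + ln (real (f j))" for i j
    proof -
      have p: "0 < real (f i)" "0 < real (f j)" "0 < real (f (i + j))"
        using pos[of i] pos[of j] pos[of "i + j"] by linarith+
      have "real (f (i + j)) \<le> real (f i) * real (f j)"
        using sub[of i j] by (metis of_nat_le_iff of_nat_mult)
      then have "ln (real (f (i + j))) \<le> ln (real (f i) * real (f j))"
        using p by simp
      then show ?thesis using p by (simp add: ln_mult)
    qed
  qed
  then show ?thesis by (auto simp: limI)
qed

text \<open>A finite sum has the exponential growth rate of its fastest term; the factor
  \<open>C\<close> and the shift by \<open>n\<close> change the logarithm divided by
  \<open>k\<close> only by something that tends to 0.\<close>

lemma growth_limit_eq_Max:
  fixes f :: "nat \<Rightarrow> nat" and g :: "'i \<Rightarrow> nat \<Rightarrow> nat"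
  assumes S: "finite S" "S \<noteq> {}"
    and pos: "\<And>i k. i \<in> S \<Longrightarrow> 1 \<le> g i k"
    and le: "\<And>i k. i \<in> S \<Longrightarrow> g i k \<le> f k"
    and ge: "\<And>k. f (n + k) \<le> C * (\<Sum>i\<in>S. g i k)"
    and f: "(\<lambda>k. ln (real (f k)) / real k) \<longlonglongrightarrow> F"
    and g: "\<And>i. i \<in> S \<Longrightarrow> (\<lambda>k. ln (real (g i k)) / real k) \<longlonglongrightarrow> G i"
  shows "F = Max (G ` S)"
proof (rule antisym)
  have "G i \<le> F" if i: "i \<in> S" for i
  proof (rule LIMSEQ_le[OF g[OF i] f], intro exI allI impI)
    fix k
    show "ln (real (g i k)) / real k \<le> ln (real (f k)) / real k"
      using pos[OF i, of k] le[OF i, of k] by (intro divide_right_mono) auto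
  qed
  then show "Max (G ` S) \<le> F" using S by simp
next
  show "F \<le> Max (G ` S)"
  proof (rule field_le_epsilon)
    fix e :: real assume e: "0 < e"
    define H where "H = Max (G ` S) + e"
    \<comment> \<open>\<open>D\<close> absorbs \<open>C\<close> and the number of summands; the
      added 1 makes it positive, so that \<open>ln D\<close> obeys the product rule.\<close>
    define D where "D = real C * real (card S) + 1"
    have Dpos: "0 < D" by (simp add: D_def add_nonneg_pos)
    have fpos: "1 \<le> f k" for k
      using S pos le by (meson all_not_in_conv le_trans)
    have "\<forall>\<^sub>F k in sequentially. \<forall>i\<in>S. ln (real (g i k)) / real k < H"
    proof (rule eventually_ball_finite[OF S(1)], rule ballI)
      fix i assume i: "i \<in> S"
      have "G i \<le> Max (G ` S)" using S i by simp
      then show "\<forall>\<^sub>F k in sequentially. ln (real (g i k)) / real k < H"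
        using order_tendstoD(2)[OF g[OF i], of H] e by (simp add: H_def)
    qed
    then have ev: "\<forall>\<^sub>F k in sequentially.
        ln (real (f (k + n))) / real (k + n) \<le> (ln D + H * real k) / real (k + n)"
      using eventually_gt_at_top[of 0]
    proof eventually_elim
      case (elim k)
      have "real (g i k) \<le> exp (H * real k)" if i: "i \<in> S" for i
      proof -
        have "ln (real (g i k)) \<le> H * real k" using elim i by (auto simp: field_simps less_imp_le)
        moreover have "real (g i k) > 0" using pos[OF i, of k] by simp
        ultimately show ?thesis by (metis exp_le_cancel_iff exp_ln)
      qed
      then have sum: "(\<Sum>i\<in>S. real (g i k)) \<le> real (card S) * exp (H * real k)"
        using sum_bounded_above[of S "\<lambda>i. real (g i k)"] by simp
      have "real (f (k + n)) \<le> real (C * (\<Sum>i\<in>S. g i k))"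
        using ge[of k] by (simp only: of_nat_le_iff add.commute)
      also have "\<dots> = real C * (\<Sum>i\<in>S. real (g i k))" by simp
      also have "\<dots> \<le> real C * (real (card S) * exp (H * real k))"
        using sum by (intro mult_left_mono) auto
      also have "\<dots> \<le> D * exp (H * real k)" by (simp add: D_def algebra_simps)
      finally have "ln (real (f (k + n))) \<le> ln (D * exp (H * real k))"
        using fpos[of "k + n"] by simp
      also have "\<dots> = ln D + H * real k"
        using Dpos by (simp add: ln_mult)
      finally show ?case by (intro divide_right_mono) auto
    qed
    have "(\<lambda>k. ln (real (f (k + n))) / real (k + n)) \<longlonglongrightarrow> F"
      using LIMSEQ_ignore_initial_segment[OF f, of n] .
    moreover have "(\<lambda>k. (ln D + H * real k) / real (k + n)) \<longlonglongrightarrow> H"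
    proof -
      have "(\<lambda>k. H + (ln D - H * real n) / real (k + n)) \<longlonglongrightarrow> H + 0"
        by (intro tendsto_add tendsto_const LIMSEQ_ignore_initial_segment[OF lim_const_over_n])
      moreover have "\<forall>\<^sub>F k in sequentially.
          H + (ln D - H * real n) / real (k + n) = (ln D + H * real k) / real (k + n)"
        using eventually_gt_at_top[of 0] by eventually_elim (simp add: field_simps)
      ultimately show ?thesis by (simp add: tendsto_cong)
    qed
    ultimately show "F \<le> Max (G ` S) + e"
      using ev tendsto_le[OF sequentially_bot] unfolding H_def by blast
  qed
qed

text \<open>Pigeonhole: two powers \<open>f^i\<close> and \<open>f^j\<close> agree on
  \<open>S\<close>, and surjectivity of \<open>f^i\<close> cancels the smaller one. This is what
  makes the least exponent \<open>p\<close> of the theorem exist.\<close>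

lemma finite_surj_power_identity:
  assumes S: "finite S" and f: "f ` S = S"
  shows "\<exists>q\<ge>1. \<forall>x\<in>S. (f ^^ q) x = x"
proof -
  have pow: "(f ^^ i) ` S = S" for i
  proof (induction i)
    case (Suc i)
    have "(f ^^ Suc i) ` S = f ` ((f ^^ i) ` S)" by (simp add: image_image)
    then show ?case by (simp only: Suc f)
  qed simp
  have "finite (PiE S (\<lambda>_. S))" using S by (simp add: finite_PiE)
  moreover have "range (\<lambda>i. restrict (f ^^ i) S) \<subseteq> PiE S (\<lambda>_. S)"
  proof (rule image_subsetI)
    fix i
    have "(f ^^ i) x \<in> S" if "x \<in> S" for x using imageI[OF that, of "f ^^ i"] by (simp only: pow)
    then show "restrict (f ^^ i) S \<in> PiE S (\<lambda>_. S)" by (rule restrict_PiE_iff[THEN iffD2, rule_format])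
  qed
  ultimately have "finite (range (\<lambda>i. restrict (f ^^ i) S))"
    by (rule rev_finite_subset)
  then have "\<not> inj (\<lambda>i. restrict (f ^^ i) S)"
    using finite_imageD infinite_UNIV_nat by blast
  then obtain i j where ij: "i < j" "restrict (f ^^ i) S = restrict (f ^^ j) S"
    unfolding inj_def by (metis nat_neq_iff)
  have "(f ^^ (j - i)) y = y" if "y \<in> S" for y
  proof -
    have "y \<in> (f ^^ i) ` S" by (simp only: pow that)
    then obtain x where x: "x \<in> S" "y = (f ^^ i) x" by blast
    have "(f ^^ (j - i)) ((f ^^ i) x) = (f ^^ (j - i + i)) x" by (simp only: funpow_add comp_apply)
    moreover have "(f ^^ i) x = (f ^^ j) x"
      using fun_cong[OF ij(2), of x] x(1) by simp
    ultimately show ?thesis using ij(1) x(2) by simp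
  qed
  then show ?thesis using ij(1) by (intro exI[of _ "j - i"]) auto
qed

section \<open>Lengths of chains of ideals\<close>

text \<open>The upper end is free, unlike in \<open>ideal_chain\<close>, because additivity of
  lengths needs chains that stop at an intermediate ideal.\<close>

definition chain_between :: "('a, 'b) ring_scheme \<Rightarrow> 'a set \<Rightarrow> 'a set \<Rightarrow> nat \<Rightarrow> bool" where
  "chain_between R I J k \<longleftrightarrow> (\<exists>F :: nat \<Rightarrow> 'a set. F 0 = I \<and> F k = J \<and>
      (\<forall>i\<le>k. ideal (F i) R) \<and> (\<forall>i<k. F i \<subset> F (Suc i)))"

text \<open>An upper bound instead of a length: it is meaningful before any finiteness is
  known.\<close>

definition length_le :: "('a, 'b) ring_scheme \<Rightarrow> 'a set \<Rightarrow> 'a set \<Rightarrow> nat \<Rightarrow> bool" where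
  "length_le R I J c \<longleftrightarrow> (\<forall>k. chain_between R I J k \<longrightarrow> k \<le> c)"

lemma ideal_subset_carrier: "ideal I R \<Longrightarrow> I \<subseteq> carrier R"
  by (intro additive_subgroup.a_subset ideal.axioms(1))

lemma ideal_chain_eq: "ideal_chain R I k \<longleftrightarrow> chain_between R I (carrier R) k"
  by (simp add: ideal_chain_def chain_between_def)

lemma chain_between_refl: "ideal I R \<Longrightarrow> chain_between R I I 0"
  unfolding chain_between_def by auto

lemma chain_between_prepend:
  assumes "chain_between R J L k" "ideal I R" "I \<subset> J"
  shows "chain_between R I L (Suc k)"
proof -
  obtain F where F: "F 0 = J" "F k = L" "\<forall>i\<le>k. ideal (F i) R" "\<forall>i<k. F i \<subset> F (Suc i)"
    using assms(1) unfolding chain_between_def by blast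
  define G where "G i = (case i of 0 \<Rightarrow> I | Suc j \<Rightarrow> F j)" for i
  have "G 0 = I \<and> G (Suc k) = L \<and> (\<forall>i\<le>Suc k. ideal (G i) R) \<and> (\<forall>i<Suc k. G i \<subset> G (Suc i))"
    using F assms by (auto simp: G_def split: nat.splits)
  then show ?thesis unfolding chain_between_def by blast
qed

lemma chain_between_append:
  assumes "chain_between R I J k" "ideal L R" "J \<subset> L"
  shows "chain_between R I L (Suc k)"
proof -
  obtain F where F: "F 0 = I" "F k = J" "\<forall>i\<le>k. ideal (F i) R" "\<forall>i<k. F i \<subset> F (Suc i)"
    using assms(1) unfolding chain_between_def by blast
  have "(F(Suc k := L)) 0 = I \<and> (F(Suc k := L)) (Suc k) = L \<and>
      (\<forall>i\<le>Suc k. ideal ((F(Suc k := L)) i) R) \<and>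
      (\<forall>i<Suc k. (F(Suc k := L)) i \<subset> (F(Suc k := L)) (Suc i))"
    using F assms by (auto simp: le_Suc_eq less_Suc_eq)
  then show ?thesis unfolding chain_between_def by blast
qed

lemma length_le_mono: "length_le R I J c \<Longrightarrow> c \<le> d \<Longrightarrow> length_le R I J d"
  unfolding length_le_def using le_trans by blast

lemma length_le_antimono:
  assumes "length_le R I J c" "ideal I R" "I \<subseteq> I'"
  shows "length_le R I' J c"
  using assms chain_between_prepend unfolding length_le_def
  by (metis Suc_leD psubsetI)

lemma length_le_refl: "length_le R I I 0"
  unfolding length_le_def chain_between_def
proof (intro allI impI, elim exE conjE)
  fix k and F :: "nat \<Rightarrow> 'a set"
  assume F: "F 0 = I" "F k = I" "\<forall>i<k. F i \<subset> F (Suc i)"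
  have "F 1 \<subseteq> F i" if "1 \<le> i" "i \<le> k" for i
    using that
  proof (induction i rule: dec_induct)
    case (step i)
    then show ?case using F(3)[rule_format, of i] by auto
  qed simp
  then show "k \<le> 0" using F by (cases k) force+
qed

text \<open>Dropping the repetitions from a weakly increasing sequence leaves a chain.\<close>
lemma weak_chain_jumps:
  assumes "length_le R (G 0) (G k) c" "\<And>i. i \<le> k \<Longrightarrow> ideal (G i) R"
    and "\<And>i. i < k \<Longrightarrow> G i \<subseteq> G (Suc i)"
  shows "card {i. i < k \<and> G i \<noteq> G (Suc i)} \<le> c"
proof -
  have "chain_between R (G 0) (G j) (card {i. i < j \<and> G i \<noteq> G (Suc i)})" if "j \<le> k" for j
    using that
  proof (induction j)
    case 0
    then show ?case using chain_between_refl[of "G 0" R] assms(2)[of 0] by simp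
  next
    case (Suc j)
    show ?case
    proof (cases "G j = G (Suc j)")
      case True
      then have "{i. i < Suc j \<and> G i \<noteq> G (Suc i)} = {i. i < j \<and> G i \<noteq> G (Suc i)}"
        by (auto simp: less_Suc_eq)
      then show ?thesis using Suc True by simp
    next
      case False
      then have "{i. i < Suc j \<and> G i \<noteq> G (Suc i)} = insert j {i. i < j \<and> G i \<noteq> G (Suc i)}"
        by (auto simp: less_Suc_eq)
      moreover have "chain_between R (G 0) (G (Suc j)) (Suc (card {i. i < j \<and> G i \<noteq> G (Suc i)}))"
        using Suc False assms(2)[of "Suc j"] assms(3)[of j]
        by (intro chain_between_append[of _ _ "G j"]) auto
      ultimately show ?thesis by simp
    qed
  qed
  then show ?thesis using assms(1) unfolding length_le_def by blast
qed

text \<open>Intersect a chain with \<open>J\<close> and add \<open>J\<close> to it. By the modular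
  law a strict step cannot become an equality in both sequences, so every step is counted among the
  jumps of one of them.\<close>

lemma (in ring) length_le_trans:
  assumes J: "ideal J R" "I \<subseteq> J" "J \<subseteq> L" and L: "ideal L R"
    and a: "length_le R I J a" and b: "length_le R J L b"
  shows "length_le R I L (a + b)"
  unfolding length_le_def chain_between_def
proof (intro allI impI, elim exE conjE)
  fix k F assume F: "F 0 = I" "F k = L" "\<forall>i\<le>k. ideal (F i) R" "\<forall>i<k. F i \<subset> F (Suc i)"
  define G where "G i = F i \<inter> J" for i
  define H where "H i = F i <+>\<^bsub>R\<^esub> J" for i
  have I: "ideal I R" using F by auto
  have add_absorb: "A <+>\<^bsub>R\<^esub> J = J" if "A \<subseteq> J" "ideal A R" for A
  proof
    show "A <+>\<^bsub>R\<^esub> J \<subseteq> J"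
      using that J by (auto simp: set_add_def' intro: additive_subgroup.a_closed[OF ideal.axioms(1)])
    show "J \<subseteq> A <+>\<^bsub>R\<^esub> J"
    proof
      fix j assume "j \<in> J"
      moreover have "\<zero> \<in> A" using that(2) by (simp add: additive_subgroup.zero_closed ideal.axioms(1))
      moreover have "\<zero> \<oplus> j = j" using \<open>j \<in> J\<close> J by (meson ideal.Icarr l_zero)
      ultimately show "j \<in> A <+>\<^bsub>R\<^esub> J" unfolding set_add_def' by blast
    qed
  qed
  have add_absorb': "L <+>\<^bsub>R\<^esub> J = L"
  proof
    show "L <+>\<^bsub>R\<^esub> J \<subseteq> L"
      using L J by (auto simp: set_add_def' intro!: additive_subgroup.a_closed[OF ideal.axioms(1)])
    show "L \<subseteq> L <+>\<^bsub>R\<^esub> J"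
    proof
      fix j assume "j \<in> L"
      moreover have "\<zero> \<in> J" using J by (simp add: additive_subgroup.zero_closed ideal.axioms(1))
      moreover have "j \<oplus> \<zero> = j" using \<open>j \<in> L\<close> L by (meson ideal.Icarr r_zero)
      ultimately show "j \<in> L <+>\<^bsub>R\<^esub> J" unfolding set_add_def' by force
    qed
  qed
  have "card {i. i < k \<and> G i \<noteq> G (Suc i)} \<le> a"
  proof (rule weak_chain_jumps)
    show "length_le R (G 0) (G k) a" using a F J by (simp add: G_def Int_absorb1 Int_absorb2)
    show "ideal (G i) R" if "i \<le> k" for i
      unfolding G_def using F(3) J(1) that by (intro i_intersect) auto
    show "G i \<subseteq> G (Suc i)" if "i < k" for i
      unfolding G_def using F(4) that by blast
  qed
  moreover have "card {i. i < k \<and> H i \<noteq> H (Suc i)} \<le> b"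
  proof (rule weak_chain_jumps)
    show "length_le R (H 0) (H k) b" using b F J I by (simp add: H_def add_absorb add_absorb')
    show "ideal (H i) R" if "i \<le> k" for i
      unfolding H_def using F(3) J(1) that by (intro add_ideals) auto
    show "H i \<subseteq> H (Suc i)" if "i < k" for i
    proof -
      have "F i \<subseteq> F (Suc i)" using F(4) that by blast
      then show ?thesis unfolding H_def set_add_def' by blast
    qed
  qed
  moreover have "{..<k} \<subseteq> {i. i < k \<and> G i \<noteq> G (Suc i)} \<union> {i. i < k \<and> H i \<noteq> H (Suc i)}"
  proof (rule ccontr)
    assume "\<not> ?thesis"
    then obtain i where i: "i < k" "G i = G (Suc i)" "H i = H (Suc i)" by auto
    then obtain x where x: "x \<in> F (Suc i)" "x \<notin> F i" using F(4) by blast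
    interpret A: ideal "F i" R using F i by simp
    interpret B: ideal "F (Suc i)" R using F i by simp
    interpret J: ideal J R by fact
    have xc: "x \<in> carrier R" using x(1) by (rule B.Icarr)
    have "x \<oplus> \<zero> \<in> H (Suc i)" unfolding H_def set_add_def' using x(1) J.zero_closed by fast
    then have "x \<in> H i" using i xc by simp
    then obtain y j where yj: "y \<in> F i" "j \<in> J" "x = y \<oplus> j" unfolding H_def set_add_def' by blast
    have "y \<in> F (Suc i)" using F(4) i yj by blast
    have "y \<in> carrier R" "j \<in> carrier R" using yj(1,2) A.Icarr J.Icarr by auto
    then have "j = x \<ominus> y" unfolding yj(3) by algebra
    then have "j \<in> F (Suc i)"
      using x(1) \<open>y \<in> F (Suc i)\<close> by (simp add: minus_eq)
    then have "j \<in> F i" using i(2) yj(2) unfolding G_def by blast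
    then show False using x(2) yj(1,3) by simp
  qed
  from card_mono[OF _ this]
  have "k \<le> card ({i. i < k \<and> G i \<noteq> G (Suc i)} \<union> {i. i < k \<and> H i \<noteq> H (Suc i)})"
    by simp
  moreover have "\<dots> \<le> card {i. i < k \<and> G i \<noteq> G (Suc i)} + card {i. i < k \<and> H i \<noteq> H (Suc i)}"
    by (rule card_Un_le)
  ultimately show "k \<le> a + b" by linarith
qed

section \<open>Adjoining one generator to an ideal\<close>

lemma (in cring) mem_genideal_insertE:
  assumes J: "ideal J R" and a: "a \<in> carrier R" and x: "x \<in> Idl (insert a J)"
  obtains j r where "j \<in> J" "r \<in> carrier R" "x = j \<oplus> r \<otimes> a"
proof -
  interpret J: ideal J R by fact
  have "insert a J \<subseteq> J <+>\<^bsub>R\<^esub> PIdl a"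
  proof
    fix y assume y: "y \<in> insert a J"
    have "\<exists>j\<in>J. \<exists>r\<in>carrier R. y = j \<oplus> r \<otimes> a"
    proof (cases "y = a")
      case True
      then show ?thesis using a by (intro bexI[of _ \<zero>] bexI[of _ \<one>]) auto
    next
      case False
      then have "y \<in> J" using y by simp
      then show ?thesis using a by (intro bexI[of _ y] bexI[of _ \<zero>]) auto
    qed
    then show "y \<in> J <+>\<^bsub>R\<^esub> PIdl a"
      unfolding set_add_def' cgenideal_def by fast
  qed
  then have "Idl (insert a J) \<subseteq> J <+>\<^bsub>R\<^esub> PIdl a"
    using J a by (intro genideal_minimal add_ideals cgenideal_ideal)
  then have "x \<in> J <+>\<^bsub>R\<^esub> PIdl a" using x by blast
  then obtain j z where "j \<in> J" "z \<in> PIdl a" "x = j \<oplus> z" unfolding set_add_def' by auto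
  moreover from this obtain r where "r \<in> carrier R" "z = r \<otimes> a" unfolding cgenideal_def by auto
  ultimately show ?thesis using that by simp
qed

lemma (in ring) genideal_insert:
  assumes "ideal J R" "a \<in> carrier R"
  shows "ideal (Idl (insert a J)) R" "a \<in> Idl (insert a J)" "J \<subseteq> Idl (insert a J)"
  using assms genideal_ideal[of "insert a J"] genideal_self[of "insert a J"]
    additive_subgroup.a_subset[OF ideal.axioms(1)] by auto

text \<open>\<open>(J + xR)/J\<close> is isomorphic to \<open>R/(J : x)\<close>, and
  \<open>D\<close> lies in \<open>(J : x)\<close>, so this factor has length at most
  \<open>c\<close>. The lemma plays the part of a short exact sequence with cyclic kernel.\<close>

lemma (in cring) length_le_cyclic_step:
  assumes J: "ideal J R" and x: "x \<in> carrier R" and D: "ideal D R"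
    and DJ: "\<And>d. d \<in> D \<Longrightarrow> x \<otimes> d \<in> J"
    and c: "length_le R D (carrier R) c"
    and c': "length_le R (Idl (insert x J)) (carrier R) c'"
  shows "length_le R J (carrier R) (c + c')"
proof (rule length_le_trans[OF _ _ _ oneideal _ c'])
  note ins = genideal_insert[OF J x]
  show "ideal (Idl (insert x J)) R" "J \<subseteq> Idl (insert x J)" using ins by auto
  then show "Idl (insert x J) \<subseteq> carrier R" by (meson ideal.Icarr subsetI)
  show "length_le R J (Idl (insert x J)) c"
    unfolding length_le_def chain_between_def
  proof (intro allI impI, elim exE conjE)
    fix k F
    assume F: "F 0 = J" "F k = Idl (insert x J)" "\<forall>i\<le>k. ideal (F i) R" "\<forall>i<k. F i \<subset> F (Suc i)"
    \<comment> \<open>\<open>G i\<close> is the colon ideal \<open>(F i : x)\<close>. An element of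
      \<open>F (Suc i)\<close> outside \<open>F i\<close> has the form \<open>j + r x\<close> with
      \<open>j\<close> in \<open>J\<close>, and then \<open>r\<close> separates
      \<open>G (Suc i)\<close> from \<open>G i\<close>.\<close>
    define G where "G i = {r \<in> carrier R. x \<otimes> r \<in> F i}" for i
    have G: "ideal (G i) R" if "i \<le> k" for i
      unfolding G_def using F that x by (intro ideal.helper_max_prime is_cring) auto
    \<comment> \<open>One induction gives both bounds: it runs upwards from \<open>F 0\<close> in
      the first conjunct and downwards from \<open>F k\<close> in the second.\<close>
    have mono: "J \<subseteq> F i \<and> F (k - i) \<subseteq> F k" if "i \<le> k" for i
      using that
    proof (induction i)
      case (Suc i)
      then have "F (k - Suc i) \<subset> F (Suc (k - Suc i))" using F(4) by auto
      moreover have "F i \<subset> F (Suc i)" using F(4) Suc.prems by auto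
      ultimately show ?case using Suc by (auto simp: Suc_diff_Suc)
    qed (use F in auto)
    have "G i \<subset> G (Suc i)" if i: "i < k" for i
    proof -
      obtain y where y: "y \<in> F (Suc i)" "y \<notin> F i" using F i by blast
      have "F (Suc i) \<subseteq> F k" using mono[of "k - Suc i"] i by simp
      then obtain j r where jr: "j \<in> J" "r \<in> carrier R" "y = j \<oplus> r \<otimes> x"
        using mem_genideal_insertE[OF J x] F y by blast
      interpret A: ideal "F i" R using F i by simp
      interpret B: ideal "F (Suc i)" R using F i by simp
      have jA: "j \<in> F i" and jB: "j \<in> F (Suc i)" using mono[of i] mono[of "Suc i"] i jr by auto
      have "x \<otimes> r = \<ominus> j \<oplus> y" using jr x jA A.Icarr by (simp add: r_neg1 m_comm)
      then have "x \<otimes> r \<in> F (Suc i)" using y jB by simp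
      moreover have "x \<otimes> r \<notin> F i"
        using jr jA y x by (auto simp: m_comm)
      ultimately have "r \<in> G (Suc i) - G i" using jr unfolding G_def by simp
      moreover have "G i \<subseteq> G (Suc i)" unfolding G_def using F(4) i by blast
      ultimately show ?thesis by blast
    qed
    moreover have "G k = carrier R"
    proof -
      have "x \<otimes> r \<in> F k" if "r \<in> carrier R" for r
        using F(2) ins that by (simp add: ideal.I_r_closed)
      then show ?thesis unfolding G_def by blast
    qed
    ultimately have "chain_between R (G 0) (carrier R) k"
      unfolding chain_between_def using G by blast
    moreover have "D \<subseteq> G 0" unfolding G_def using F D DJ by (auto intro: ideal.Icarr)
    ultimately show "k \<le> c"
      using length_le_antimono[OF c D] unfolding length_le_def by blast
  qed
qed

lemma (in ring) exists_ideal_chain: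
  assumes I: "ideal I R"
  shows "\<exists>k. chain_between R I (carrier R) k"
    and "I \<noteq> carrier R \<Longrightarrow> chain_between R I (carrier R) 1"
proof -
  show *: "chain_between R I (carrier R) 1" if "I \<noteq> carrier R"
    using chain_between_prepend[OF chain_between_refl[OF oneideal] I] that
      additive_subgroup.a_subset[OF ideal.axioms(1)[OF I]] by (simp add: psubset_eq)
  show "\<exists>k. chain_between R I (carrier R) k"
    using * chain_between_refl[OF I] by metis
qed

text \<open>A single finite bound makes the supremum that defines \<open>quot_length\<close> a
  genuine one. Then \<open>quot_length\<close> is itself a bound, and the least one.\<close>

lemma (in ring)
  assumes I: "ideal I R" and c: "length_le R I (carrier R) c"
  shows length_le_quot_length: "length_le R I (carrier R) (quot_length R I)"
    and quot_length_le: "quot_length R I \<le> c"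
    and quot_length_ge_1: "I \<noteq> carrier R \<Longrightarrow> 1 \<le> quot_length R I"
proof -
  have bdd: "bdd_above {k. ideal_chain R I k}"
    using c unfolding length_le_def ideal_chain_eq by (intro bdd_aboveI[of _ c]) auto
  show "length_le R I (carrier R) (quot_length R I)"
    unfolding length_le_def quot_length_def ideal_chain_eq[symmetric]
    using cSup_upper[OF _ bdd] by simp
  then show "I \<noteq> carrier R \<Longrightarrow> 1 \<le> quot_length R I"
    using exists_ideal_chain(2)[OF I] unfolding length_le_def by blast
  show "quot_length R I \<le> c"
    unfolding quot_length_def
    using c exists_ideal_chain(1)[OF I] by (intro cSup_least) (auto simp: length_le_def ideal_chain_eq)
qed

section \<open>Primes in Noetherian rings\<close>

text \<open>Represents \<open>Min_primes (R Quot J)\<close> by ideals of \<open>R\<close>;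
  \<open>Min_primes_quot\<close> gives the correspondence.\<close>

definition minimal_primes_over :: "('a, 'b) ring_scheme \<Rightarrow> 'a set \<Rightarrow> 'a set set" where
  "minimal_primes_over R J = {P. primeideal P R \<and> J \<subseteq> P \<and>
     (\<forall>Q. primeideal Q R \<and> J \<subseteq> Q \<and> Q \<subseteq> P \<longrightarrow> Q = P)}"

lemma (in noetherian_ring) noetherian_maximal_element:
  assumes "S \<noteq> {}" "\<And>I. I \<in> S \<Longrightarrow> ideal I R"
  shows "\<exists>M\<in>S. \<forall>I\<in>S. M \<subseteq> I \<longrightarrow> I = M"
proof (rule subset_Zorn_nonempty[OF assms(1)])
  fix C assume C: "C \<noteq> {}" "subset.chain S C"
  then have "subset.chain {I. ideal I R} C"
    using assms(2) unfolding subset_chain_def by blast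
  then have "\<Union>C \<in> C" using C ideal_chain_is_trivial by blast
  then show "\<Union>C \<in> S" using C(2) unfolding subset_chain_def by blast
qed

locale noetherian_cring = cring R + noetherian_ring R for R (structure)
begin

text \<open>If \<open>J\<close> is neither prime nor the whole ring, say \<open>a b \<in> J\<close> with \<open>a, b \<notin> J\<close>, then both \<open>J + aR\<close> and
  \<open>(J : a)\<close> are strictly larger than \<open>J\<close>.\<close>
lemma noetherian_colon_induct:
  assumes J: "ideal J R"
    and carrier: "Q (carrier R)"
    and prime: "\<And>P. primeideal P R \<Longrightarrow> J \<subseteq> P \<Longrightarrow> Q P"
    and step: "\<And>I a. ideal I R \<Longrightarrow> J \<subseteq> I \<Longrightarrow> a \<in> carrier R \<Longrightarrow> Q (Idl (insert a I)) \<Longrightarrow>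
      Q {r \<in> carrier R. a \<otimes> r \<in> I} \<Longrightarrow> Q I"
  shows "Q J"
proof (rule ccontr)
  assume "\<not> Q J"
  define S where "S = {I. ideal I R \<and> J \<subseteq> I \<and> \<not> Q I}"
  have "\<exists>M\<in>S. \<forall>I\<in>S. M \<subseteq> I \<longrightarrow> I = M"
    using J \<open>\<not> Q J\<close> by (intro noetherian_maximal_element) (auto simp: S_def)
  then obtain M where "M \<in> S" and maxS: "\<forall>I\<in>S. M \<subseteq> I \<longrightarrow> I = M" by (rule bexE)
  then have M: "ideal M R" "J \<subseteq> M" "\<not> Q M" by (simp_all add: S_def)
  have max: "Q I" if "ideal I R" "M \<subset> I" for I
  proof (rule ccontr)
    assume "\<not> Q I"
    then have "I \<in> S" using that M(2) by (auto simp: S_def)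
    then show False using maxS that(2) by auto
  qed
  have "\<not> primeideal M R" using M(2,3) prime by blast
  moreover have "carrier R \<noteq> M" using M(3) carrier by metis
  ultimately obtain a b where ab: "a \<in> carrier R" "b \<in> carrier R" "a \<otimes> b \<in> M" "a \<notin> M" "b \<notin> M"
    by (elim ideal.primeidealCE[OF M(1) is_cring]) blast+
  interpret M: ideal M R by fact
  have "Q (Idl (insert a M))"
    using genideal_insert[OF M(1) ab(1)] ab(4) by (intro max) auto
  moreover have "Q {r \<in> carrier R. a \<otimes> r \<in> M}"
  proof (rule max)
    show "ideal {r \<in> carrier R. a \<otimes> r \<in> M} R" using ab(1) by (rule M.helper_max_prime[OF is_cring])
    show "M \<subset> {r \<in> carrier R. a \<otimes> r \<in> M}" using ab M.I_l_closed M.Icarr by blast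
  qed
  ultimately show False using step[OF M(1,2) ab(1)] M(3) by simp
qed

text \<open>If \<open>I + aR\<close> and \<open>(I : a)\<close> met \<open>S\<close> in
  \<open>s = j + r a\<close> and \<open>t\<close>, then \<open>s t = j t + r (a t)\<close> would lie
  in both \<open>I\<close> and \<open>S\<close>. So one of the two larger ideals still avoids
  \<open>S\<close>.\<close>

lemma exists_prime_disjoint:
  assumes J: "ideal J R" and one: "\<one> \<in> S" and mult: "\<And>s t. s \<in> S \<Longrightarrow> t \<in> S \<Longrightarrow> s \<otimes> t \<in> S"
    and disj: "J \<inter> S = {}"
  shows "\<exists>P. primeideal P R \<and> J \<subseteq> P \<and> P \<inter> S = {}"
proof -
  have "J \<inter> S = {} \<longrightarrow> (\<exists>P. primeideal P R \<and> J \<subseteq> P \<and> P \<inter> S = {})"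
  proof (rule noetherian_colon_induct[OF J])
    show "carrier R \<inter> S = {} \<longrightarrow> (\<exists>P. primeideal P R \<and> carrier R \<subseteq> P \<and> P \<inter> S = {})"
      using one by blast
    show "P \<inter> S = {} \<longrightarrow> (\<exists>P'. primeideal P' R \<and> P \<subseteq> P' \<and> P' \<inter> S = {})" if "primeideal P R" for P
      using that by blast
    fix I a assume I: "ideal I R" and a: "a \<in> carrier R"
      and IH1: "Idl (insert a I) \<inter> S = {} \<longrightarrow> (\<exists>P. primeideal P R \<and> Idl (insert a I) \<subseteq> P \<and> P \<inter> S = {})"
      and IH2: "{r \<in> carrier R. a \<otimes> r \<in> I} \<inter> S = {} \<longrightarrow>
        (\<exists>P. primeideal P R \<and> {r \<in> carrier R. a \<otimes> r \<in> I} \<subseteq> P \<and> P \<inter> S = {})"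
    interpret I: ideal I R by fact
    have I1: "I \<subseteq> Idl (insert a I)" by (rule genideal_insert(3)[OF I a])
    have I2: "I \<subseteq> {r \<in> carrier R. a \<otimes> r \<in> I}" using a I.I_l_closed I.Icarr by auto
    show "I \<inter> S = {} \<longrightarrow> (\<exists>P. primeideal P R \<and> I \<subseteq> P \<and> P \<inter> S = {})"
    proof
      assume dI: "I \<inter> S = {}"
      have "Idl (insert a I) \<inter> S = {} \<or> {r \<in> carrier R. a \<otimes> r \<in> I} \<inter> S = {}"
      proof (rule ccontr)
        assume "\<not> ?thesis"
        then obtain s t where st: "s \<in> Idl (insert a I)" "s \<in> S" "t \<in> carrier R" "a \<otimes> t \<in> I" "t \<in> S"
          by auto
        obtain j r where jr: "j \<in> I" "r \<in> carrier R" "s = j \<oplus> r \<otimes> a"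
          by (rule mem_genideal_insertE[OF I a st(1)])
        have "j \<in> carrier R" using jr(1) by (rule I.Icarr)
        then have "s \<otimes> t = j \<otimes> t \<oplus> r \<otimes> (a \<otimes> t)" unfolding jr(3) using jr(2) a st(3) by algebra
        moreover have "j \<otimes> t \<oplus> r \<otimes> (a \<otimes> t) \<in> I"
          using jr(1,2) st(3,4) I.I_l_closed I.I_r_closed by simp
        ultimately show False using mult[OF st(2,5)] dI by auto
      qed
      then show "\<exists>P. primeideal P R \<and> I \<subseteq> P \<and> P \<inter> S = {}"
        using IH1 IH2 I1 I2 by (elim disjE) (meson order_trans)+
    qed
  qed
  then show ?thesis using disj by blast
qed

text \<open>A prime over \<open>I\<close> contains \<open>a\<close>, hence \<open>I + aR\<close>, or
  omits \<open>a\<close>, hence contains \<open>(I : a)\<close>. The finite sets for the two larger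
  ideals can thus be united; their members need not be minimal primes.\<close>

lemma finite_primes_below:
  assumes J: "ideal J R"
  shows "\<exists>S. finite S \<and> (\<forall>P\<in>S. primeideal P R \<and> J \<subseteq> P) \<and>
    (\<forall>P. primeideal P R \<and> J \<subseteq> P \<longrightarrow> (\<exists>Q\<in>S. Q \<subseteq> P))"
proof (rule noetherian_colon_induct[OF J])
  have "\<not> carrier R \<subseteq> P" if "primeideal P R" for P
    using primeideal.I_notcarr[OF that] ideal_subset_carrier[OF primeideal.axioms(1)[OF that]] by blast
  then show "\<exists>S. finite S \<and> (\<forall>P\<in>S. primeideal P R \<and> carrier R \<subseteq> P) \<and>
      (\<forall>P. primeideal P R \<and> carrier R \<subseteq> P \<longrightarrow> (\<exists>Q\<in>S. Q \<subseteq> P))"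
    by (intro exI[of _ "{}"]) auto
  show "\<exists>S. finite S \<and> (\<forall>P'\<in>S. primeideal P' R \<and> P \<subseteq> P') \<and>
      (\<forall>P'. primeideal P' R \<and> P \<subseteq> P' \<longrightarrow> (\<exists>Q\<in>S. Q \<subseteq> P'))" if "primeideal P R" for P
    using that by (intro exI[of _ "{P}"]) auto
  fix I a assume I: "ideal I R" and a: "a \<in> carrier R"
    and "\<exists>S. finite S \<and> (\<forall>P\<in>S. primeideal P R \<and> Idl (insert a I) \<subseteq> P) \<and>
      (\<forall>P. primeideal P R \<and> Idl (insert a I) \<subseteq> P \<longrightarrow> (\<exists>Q\<in>S. Q \<subseteq> P))"
    and "\<exists>S. finite S \<and> (\<forall>P\<in>S. primeideal P R \<and> {r \<in> carrier R. a \<otimes> r \<in> I} \<subseteq> P) \<and>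
      (\<forall>P. primeideal P R \<and> {r \<in> carrier R. a \<otimes> r \<in> I} \<subseteq> P \<longrightarrow> (\<exists>Q\<in>S. Q \<subseteq> P))"
  then obtain S T where S: "finite S" "\<forall>P\<in>S. primeideal P R \<and> Idl (insert a I) \<subseteq> P"
      "\<forall>P. primeideal P R \<and> Idl (insert a I) \<subseteq> P \<longrightarrow> (\<exists>Q\<in>S. Q \<subseteq> P)"
    and T: "finite T" "\<forall>P\<in>T. primeideal P R \<and> {r \<in> carrier R. a \<otimes> r \<in> I} \<subseteq> P"
      "\<forall>P. primeideal P R \<and> {r \<in> carrier R. a \<otimes> r \<in> I} \<subseteq> P \<longrightarrow> (\<exists>Q\<in>T. Q \<subseteq> P)"
    by (elim exE conjE)
  interpret I: ideal I R by fact
  have I1: "I \<subseteq> Idl (insert a I)" by (rule genideal_insert(3)[OF I a])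
  have I2: "I \<subseteq> {r \<in> carrier R. a \<otimes> r \<in> I}" using a I.I_l_closed I.Icarr by auto
  have below: "\<exists>Q\<in>S \<union> T. Q \<subseteq> P" if P: "primeideal P R" "I \<subseteq> P" for P
  proof (cases "a \<in> P")
    case True
    then have "Idl (insert a I) \<subseteq> P"
      using P by (intro genideal_minimal primeideal.axioms(1)) auto
    then show ?thesis using S(3) P(1) by blast
  next
    case False
    then have "{r \<in> carrier R. a \<otimes> r \<in> I} \<subseteq> P"
      using primeideal.I_prime[OF P(1) a] P(2) by blast
    then show ?thesis using T(3) P(1) by blast
  qed
  show "\<exists>S. finite S \<and> (\<forall>P\<in>S. primeideal P R \<and> I \<subseteq> P) \<and>
      (\<forall>P. primeideal P R \<and> I \<subseteq> P \<longrightarrow> (\<exists>Q\<in>S. Q \<subseteq> P))"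
  proof (intro exI[of _ "S \<union> T"] conjI allI impI ballI)
    show "finite (S \<union> T)" using S T by simp
    show "primeideal P R" "I \<subseteq> P" if "P \<in> S \<union> T" for P
      using that S(2) T(2) I1 I2 by (blast, blast)
    show "\<exists>Q\<in>S \<union> T. Q \<subseteq> P" if "primeideal P R \<and> I \<subseteq> P" for P
      using that below by blast
  qed
qed

lemma finite_minimal_primes_over:
  assumes "ideal J R"
  shows "finite (minimal_primes_over R J)"
proof -
  obtain S where S: "finite S" "\<forall>P\<in>S. primeideal P R \<and> J \<subseteq> P"
    "\<forall>P. primeideal P R \<and> J \<subseteq> P \<longrightarrow> (\<exists>Q\<in>S. Q \<subseteq> P)"
    using finite_primes_below[OF assms] by (elim exE conjE)
  have "minimal_primes_over R J \<subseteq> S"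
  proof
    fix P assume P: "P \<in> minimal_primes_over R J"
    then obtain Q where "Q \<in> S" "Q \<subseteq> P" using S(3) unfolding minimal_primes_over_def by auto
    then show "P \<in> S" using P S(2) unfolding minimal_primes_over_def by auto
  qed
  then show ?thesis using S(1) finite_subset by blast
qed

lemma minimal_prime_below:
  assumes J: "ideal J R" and P: "primeideal P R" "J \<subseteq> P"
  shows "\<exists>Q\<in>minimal_primes_over R J. Q \<subseteq> P"
proof -
  obtain S where S: "finite S" "\<forall>P\<in>S. primeideal P R \<and> J \<subseteq> P"
    "\<forall>P. primeideal P R \<and> J \<subseteq> P \<longrightarrow> (\<exists>Q\<in>S. Q \<subseteq> P)"
    using finite_primes_below[OF J] by (elim exE conjE)
  \<comment> \<open>A minimal element of \<open>T\<close> is minimal among all primes over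
    \<open>J\<close>, since each of these contains a member of \<open>S\<close>.\<close>
  define T where "T = {Q \<in> S. Q \<subseteq> P}"
  have "finite T" "T \<noteq> {}" using S P unfolding T_def by auto
  then obtain Q where Q: "Q \<in> T" and minQ: "\<forall>Q'\<in>T. Q' \<subseteq> Q \<longrightarrow> Q = Q'"
    using finite_has_minimal[of T] by blast
  have "Q' = Q" if Q': "primeideal Q' R" "J \<subseteq> Q'" "Q' \<subseteq> Q" for Q'
  proof -
    obtain Q'' where "Q'' \<in> S" "Q'' \<subseteq> Q'" using S(3) Q' by blast
    moreover from this have "Q'' \<in> T" using Q Q' unfolding T_def by auto
    ultimately show ?thesis using minQ Q' by blast
  qed
  then have "Q \<in> minimal_primes_over R J"
    using Q S(2) unfolding minimal_primes_over_def T_def by auto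
  then show ?thesis using Q unfolding T_def by blast
qed

text \<open>Contraction along \<open>\<phi>\<close> is surjective on the finite set of minimal primes over \<open>K\<close>: a prime containing
  \<open>K\<close> and maximal outside \<open>\<phi>(R - P)\<close> contracts into, hence onto, the minimal prime \<open>P\<close>.\<close>
lemma contraction_permutes_minimal_primes:
  assumes phi: "\<phi> \<in> ring_hom R R" and K: "ideal K R"
    and contr: "\<And>x. x \<in> carrier R \<Longrightarrow> \<phi> x \<in> K \<longleftrightarrow> x \<in> K"
  shows "(\<lambda>P. {x \<in> carrier R. \<phi> x \<in> P}) ` minimal_primes_over R K = minimal_primes_over R K"
    (is "?F ` ?M = ?M")
proof -
  interpret phi: ring_hom_ring R R \<phi>
    using phi by (intro ring_hom_ringI2 ring_axioms)
  have "P \<in> ?F ` ?M" if P: "P \<in> ?M" for P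
  proof -
    have prime: "primeideal P R" and KP: "K \<subseteq> P"
      and minP: "\<And>Q. primeideal Q R \<Longrightarrow> K \<subseteq> Q \<Longrightarrow> Q \<subseteq> P \<Longrightarrow> Q = P"
      using P unfolding minimal_primes_over_def by auto
    interpret P: primeideal P R by (rule prime)
    define S where "S = \<phi> ` (carrier R - P)"
    have "\<one> \<notin> P" using P.one_imp_carrier P.I_notcarr by auto
    then have "\<phi> \<one> \<in> S" unfolding S_def by (intro imageI) simp
    then have one: "\<one> \<in> S" by simp
    have mult: "s \<otimes> t \<in> S" if st: "s \<in> S" "t \<in> S" for s t
    proof -
      obtain x y where xy: "x \<in> carrier R" "x \<notin> P" "s = \<phi> x" "y \<in> carrier R" "y \<notin> P" "t = \<phi> y"
        using st unfolding S_def by auto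
      then have "s \<otimes> t = \<phi> (x \<otimes> y)" by simp
      moreover have "x \<otimes> y \<in> carrier R - P" using xy P.I_prime by auto
      ultimately show ?thesis unfolding S_def by simp
    qed
    \<comment> \<open>Here injectivity modulo \<open>K\<close> enters: \<open>\<phi> x\<close> in
      \<open>K\<close> forces \<open>x\<close> into \<open>K\<close>, hence into
      \<open>P\<close>.\<close>
    have "K \<inter> S = {}" unfolding S_def using contr KP by auto
    then obtain Q where Q: "primeideal Q R" "K \<subseteq> Q" "Q \<inter> S = {}"
      using exists_prime_disjoint[OF K one mult] by auto
    obtain Q' where Q': "Q' \<in> ?M" "Q' \<subseteq> Q" using minimal_prime_below[OF K Q(1,2)] by auto
    then have "primeideal Q' R" "K \<subseteq> Q'" unfolding minimal_primes_over_def by auto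
    then have "primeideal (?F Q') R" by (intro phi.primeideal_vimage is_cring)
    moreover have "K \<subseteq> ?F Q'"
      using contr \<open>K \<subseteq> Q'\<close> ideal_subset_carrier[OF K] by auto
    moreover have "?F Q' \<subseteq> P" using Q' Q(3) unfolding S_def by auto
    ultimately have "?F Q' = P" by (rule minP)
    then show ?thesis by (intro image_eqI[OF _ Q'(1)]) simp
  qed
  then have sub: "?M \<subseteq> ?F ` ?M" by blast
  \<comment> \<open>The image covers \<open>?M\<close> and has at most as many elements, so the two
    coincide. It need not be checked separately that a minimal prime contracts to a minimal
    one.\<close>
  have fin: "finite ?M" by (rule finite_minimal_primes_over[OF K])
  show ?thesis using card_seteq[OF finite_imageI[OF fin] sub card_image_le[OF fin]] by simp
qed

end

section \<open>Local rings and self-maps of finite length\<close>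

lemma (in cring) image_genideal_subset:
  assumes psi: "\<psi> \<in> ring_hom R R" and T: "ideal T R" and S: "S \<subseteq> carrier R" "\<psi> ` S \<subseteq> T"
  shows "\<psi> ` (Idl S) \<subseteq> T"
proof -
  interpret psi: ring_hom_ring R R \<psi>
    using psi by (intro ring_hom_ringI2 ring_axioms)
  have "Idl S \<subseteq> {r \<in> carrier R. \<psi> r \<in> T}"
    using S by (intro genideal_minimal psi.ideal_vimage[OF T]) auto
  then show ?thesis by auto
qed

lemma funpow_ring_hom: "\<phi> \<in> ring_hom R R \<Longrightarrow> \<phi> ^^ k \<in> ring_hom R R"
proof (induction k)
  case 0
  then show ?case by (auto simp: ring_hom_def)
next
  case (Suc k)
  then show ?case using ring_hom_trans[of "\<phi> ^^ k" R R \<phi> R] by (simp only: funpow.simps)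
qed

lemma funpow_image_subset:
  assumes "f ` S \<subseteq> S"
  shows "(f ^^ k) ` S \<subseteq> S"
proof (induction k)
  case (Suc k)
  have "(f ^^ Suc k) ` S = f ` ((f ^^ k) ` S)" by (simp add: image_image)
  then show ?case using Suc assms by blast
qed simp

section \<open>Noetherian local rings and extension of ideals along an endomorphism\<close>

locale noetherian_local_ring = noetherian_cring R for R (structure) +
  fixes m
  assumes maximal: "maximalideal m R"
    and unique_maximal: "maximalideal M R \<Longrightarrow> M = m"
begin

lemma m_ideal: "ideal m R"
  using maximal by (rule maximalideal.axioms(1))

lemma m_subset: "m \<subseteq> carrier R"
  by (rule ideal_subset_carrier[OF m_ideal])

lemma one_notin_m: "\<one> \<notin> m"
  using maximalideal.I_notcarr[OF maximal] ideal.one_imp_carrier[OF m_ideal] by auto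

lemma loc_max_eq: "loc_max R = m"
  unfolding loc_max_def using maximal unique_maximal by (rule the_equality)

lemma proper_ideal_subset_m:
  assumes J: "ideal J R" "J \<noteq> carrier R"
  shows "J \<subseteq> m"
proof -
  define S where "S = {I. ideal I R \<and> J \<subseteq> I \<and> I \<noteq> carrier R}"
  have "\<exists>M\<in>S. \<forall>I\<in>S. M \<subseteq> I \<longrightarrow> I = M"
    using J by (intro noetherian_maximal_element) (auto simp: S_def)
  then obtain M where M: "M \<in> S" and maxS: "\<forall>I\<in>S. M \<subseteq> I \<longrightarrow> I = M" by (rule bexE)
  have "maximalideal M R"
  proof (rule maximalidealI)
    show "ideal M R" "carrier R \<noteq> M" using M by (auto simp: S_def)
    fix I assume I: "ideal I R" "M \<subseteq> I" "I \<subseteq> carrier R"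
    show "I = M \<or> I = carrier R"
    proof (rule disjCI)
      assume "I \<noteq> carrier R"
      then have "I \<in> S" using I M by (auto simp: S_def)
      then show "I = M" using maxS I by blast
    qed
  qed
  then have "M = m" by (rule unique_maximal)
  then show ?thesis using M by (simp add: S_def)
qed

lemma right_inverse_of_not_mem_m:
  assumes x: "x \<in> carrier R" "x \<notin> m"
  obtains y where "y \<in> carrier R" "x \<otimes> y = \<one>"
proof -
  have "PIdl x = carrier R"
    using proper_ideal_subset_m[OF cgenideal_ideal[OF x(1)]] cgenideal_self[OF x(1)] x(2) by blast
  then have "\<one> \<in> PIdl x" by simp
  then obtain y where "y \<in> carrier R" "\<one> = y \<otimes> x" unfolding cgenideal_def by auto
  then show ?thesis using that x m_comm by simp
qed

text \<open>Take \<open>x\<close> outside \<open>J\<close> with the longest possible chain above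
  \<open>J + xR\<close>. If \<open>x y\<close> were outside \<open>J\<close> for some
  \<open>y\<close> in \<open>m\<close>, then \<open>J + xyR\<close> would be strictly smaller by a
  Nakayama argument and would start a longer chain.\<close>

lemma exists_socle_element:
  assumes J: "ideal J R" "J \<noteq> carrier R" and fin: "length_le R J (carrier R) a"
  shows "\<exists>x\<in>carrier R. x \<notin> J \<and> (\<forall>y\<in>m. x \<otimes> y \<in> J)"
proof -
  define S where "S = {k. \<exists>x\<in>carrier R - J. chain_between R (Idl (insert x J)) (carrier R) k}"
  have prepend: "chain_between R J (carrier R) (Suc k)"
    if "x \<in> carrier R - J" "chain_between R (Idl (insert x J)) (carrier R) k" for x k
    using chain_between_prepend[OF that(2) J(1)] genideal_insert[OF J(1), of x] that(1) by blast
  have bdd: "k \<le> a" if "k \<in> S" for k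
    using that prepend fin unfolding S_def length_le_def by (blast dest: Suc_leD)
  obtain x0 where x0: "x0 \<in> carrier R - J"
    using J ideal_subset_carrier by blast
  then obtain k0 where "k0 \<in> S"
    unfolding S_def using exists_ideal_chain(1)[OF genideal_insert(1)[OF J(1), of x0]] by blast
  have finS: "finite S" using bdd by (meson finite_nat_set_iff_bounded_le)
  have "Max S \<in> S" using finS \<open>k0 \<in> S\<close> by (intro Max_in) auto
  then obtain x where x: "x \<in> carrier R - J"
    and chain: "chain_between R (Idl (insert x J)) (carrier R) (Max S)" unfolding S_def by auto
  have xc: "x \<in> carrier R" and xJ: "x \<notin> J" using x by auto
  show ?thesis
  proof (intro bexI[OF _ xc] conjI[OF xJ] ballI, rule ccontr)
    fix y assume y: "y \<in> m" and xy: "x \<otimes> y \<notin> J"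
    have yc: "y \<in> carrier R" using y m_subset by blast
    have xyc: "x \<otimes> y \<in> carrier R" using xc yc by simp
    interpret J: ideal J R by fact
    note I1 = genideal_insert[OF J(1) xc] and I2 = genideal_insert[OF J(1) xyc]
    have "Idl (insert (x \<otimes> y) J) \<subseteq> Idl (insert x J)"
      using I1 yc by (intro genideal_minimal) (auto simp: ideal.I_r_closed)
    moreover have "x \<notin> Idl (insert (x \<otimes> y) J)"
    proof
      assume "x \<in> Idl (insert (x \<otimes> y) J)"
      then obtain j r where jr: "j \<in> J" "r \<in> carrier R" "x = j \<oplus> r \<otimes> (x \<otimes> y)"
        by (rule mem_genideal_insertE[OF J(1) xyc])
      have jc: "j \<in> carrier R" using jr(1) by (rule J.Icarr)
      have ry: "r \<otimes> y \<in> m" using jr(2) y by (rule ideal.I_l_closed[OF m_ideal, rotated])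
      \<comment> \<open>From \<open>x = j + r x y\<close> follows \<open>x u = j\<close>, and
        \<open>u\<close> is a unit because \<open>r y\<close> lies in \<open>m\<close>; so
        \<open>x\<close> would lie in \<open>J\<close>.\<close>
      define u where "u = \<one> \<ominus> r \<otimes> y"
      have uc: "u \<in> carrier R" unfolding u_def using jr yc by simp
      have "u \<notin> m"
      proof
        assume "u \<in> m"
        then have "u \<oplus> r \<otimes> y \<in> m"
          using ry by (rule additive_subgroup.a_closed[OF ideal.axioms(1)[OF m_ideal]])
        moreover have "u \<oplus> r \<otimes> y = \<one>" unfolding u_def using jr(2) yc by algebra
        ultimately show False using one_notin_m by simp
      qed
      then obtain v where v: "v \<in> carrier R" "u \<otimes> v = \<one>"
        using right_inverse_of_not_mem_m[OF uc] by blast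
      have "x \<ominus> r \<otimes> (x \<otimes> y) = j"
        by (subst jr(3)) (use jr(2) jc xc yc in algebra)
      then have xu: "x \<otimes> u = j" unfolding u_def using jr(2) xc yc by algebra
      have "x = (x \<otimes> u) \<otimes> v" using xc uc v by (simp add: m_assoc)
      then have "x \<in> J" unfolding xu using J.I_r_closed[OF jr(1) v(1)] by simp
      then show False using xJ by simp
    qed
    ultimately have "Idl (insert (x \<otimes> y) J) \<subset> Idl (insert x J)" using I1(2) by blast
    from chain_between_prepend[OF chain I2(1) this]
    have "Suc (Max S) \<in> S" unfolding S_def using xyc xy by blast
    then show False using Max_ge[OF finS, of "Suc (Max S)"] by simp
  qed
qed

text \<open>Extending a composition series of \<open>R/J\<close> along \<open>\<psi>\<close> gives a filtration of \<open>R/(Q + \<psi>(J)R)\<close> whose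
  factors are cyclic and killed by \<open>Q + \<psi>(m)R\<close>.\<close>
lemma length_le_extension:
  assumes psi: "\<psi> \<in> ring_hom R R" and Q: "Q \<subseteq> carrier R"
    and b: "length_le R (Idl (Q \<union> \<psi> ` m)) (carrier R) b"
    and "ideal J R" "length_le R J (carrier R) a"
  shows "length_le R (Idl (Q \<union> \<psi> ` J)) (carrier R) (a * b)"
  using assms(4,5)
proof (induction a arbitrary: J)
  case a: (Suc a J)
  interpret psi: ring_hom_ring R R \<psi>
    using psi by (intro ring_hom_ringI2 ring_axioms)
  have ext: "Q \<union> \<psi> ` I \<subseteq> carrier R" if "ideal I R" for I
    using Q ideal_subset_carrier[OF that] by auto
  note extI = genideal_ideal[OF ext] and ext_self = genideal_self[OF ext]
  show ?case
  proof (cases "J = carrier R")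
    case True
    have "\<psi> \<one> \<in> \<psi> ` J" using True by (intro imageI) simp
    then have "\<psi> \<one> \<in> Idl (Q \<union> \<psi> ` J)" using ext_self[OF a.prems(1)] by (rule_tac subsetD) auto
    then have "\<one> \<in> Idl (Q \<union> \<psi> ` J)" by simp
    then have "Idl (Q \<union> \<psi> ` J) = carrier R"
      by (rule ideal.one_imp_carrier[OF extI[OF a.prems(1)]])
    then show ?thesis using length_le_mono[OF length_le_refl[of R "carrier R"]] by simp
  next
    case False
    obtain x where x: "x \<in> carrier R" "x \<notin> J" and xm: "\<forall>y\<in>m. x \<otimes> y \<in> J"
      using exists_socle_element[OF a.prems(1) False a.prems(2)] by blast
    define J' where "J' = Idl (insert x J)"
    have J': "ideal J' R" "x \<in> J'" "J \<subseteq> J'"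
      unfolding J'_def using genideal_insert[OF a.prems(1) x(1)] by auto
    \<comment> \<open>Putting \<open>J\<close> in front lengthens any chain that starts at
      \<open>J'\<close>, so one unit of the bound is released for the induction.\<close>
    have "length_le R J' (carrier R) a"
      unfolding length_le_def
    proof (intro allI impI)
      fix k assume "chain_between R J' (carrier R) k"
      then have "chain_between R J (carrier R) (Suc k)"
        using a.prems(1) J' x by (intro chain_between_prepend[of _ J']) auto
      then show "k \<le> a" using a.prems(2) unfolding length_le_def by auto
    qed
    then have IH: "length_le R (Idl (Q \<union> \<psi> ` J')) (carrier R) (a * b)"
      by (rule a.IH[OF J'(1)])
    define T where "T = Idl (Q \<union> \<psi> ` J)"
    have T: "ideal T R" "Q \<subseteq> T" "\<psi> ` J \<subseteq> T"
      unfolding T_def using extI[OF a.prems(1)] ext_self[OF a.prems(1)] by auto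
    have psix: "\<psi> x \<in> carrier R" using x(1) by simp
    note T' = genideal_insert[OF T(1) psix]
    have "\<psi> ` J' \<subseteq> Idl (insert (\<psi> x) T)"
      unfolding J'_def using T T' x(1) ideal_subset_carrier[OF a.prems(1)]
      by (intro image_genideal_subset psi) auto
    then have "Idl (Q \<union> \<psi> ` J') \<subseteq> Idl (insert (\<psi> x) T)"
      using T T' by (intro genideal_minimal) auto
    then have "length_le R (Idl (insert (\<psi> x) T)) (carrier R) (a * b)"
      by (rule length_le_antimono[OF IH extI[OF J'(1)]])
    \<comment> \<open>The socle property \<open>x m \<subseteq> J\<close> becomes
      \<open>\<psi>(x) \<psi>(m) \<subseteq> T\<close>, so the new cyclic factor is a quotient of
      \<open>R/(Q + \<psi>(m)R)\<close> and costs at most \<open>b\<close>.\<close>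
    moreover have "\<psi> x \<otimes> d \<in> T" if "d \<in> Idl (Q \<union> \<psi> ` m)" for d
    proof -
      have "Idl (Q \<union> \<psi> ` m) \<subseteq> {r \<in> carrier R. \<psi> x \<otimes> r \<in> T}"
      proof (rule genideal_minimal)
        show "ideal {r \<in> carrier R. \<psi> x \<otimes> r \<in> T} R"
          using psix by (rule ideal.helper_max_prime[OF T(1) is_cring])
        have "\<psi> x \<otimes> \<psi> y \<in> T" if "y \<in> m" for y
        proof -
          have "\<psi> (x \<otimes> y) \<in> T" using xm T(3) that by blast
          then show ?thesis using x(1) that m_subset by (simp add: subsetD)
        qed
        moreover have "\<psi> x \<otimes> q \<in> T" if "q \<in> Q" for q
          using that T(2) psix by (intro ideal.I_l_closed[OF T(1)]) auto
        ultimately show "Q \<union> \<psi> ` m \<subseteq> {r \<in> carrier R. \<psi> x \<otimes> r \<in> T}"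
          using ext[OF m_ideal] by auto
      qed
      then show ?thesis using that by auto
    qed
    ultimately have "length_le R T (carrier R) (b + a * b)"
      by (intro length_le_cyclic_step[OF T(1) psix extI[OF m_ideal] _ b])
    then show ?thesis by (simp add: T_def)
  qed
next
  case 0
  have "J = carrier R"
    using 0 exists_ideal_chain(2)[OF 0(1)] unfolding length_le_def by fastforce
  moreover have "Idl (Q \<union> \<psi> ` carrier R) = carrier R"
  proof -
    interpret psi: ring_hom_ring R R \<psi>
      using psi by (intro ring_hom_ringI2 ring_axioms)
    have sub: "Q \<union> \<psi> ` carrier R \<subseteq> carrier R" using Q by auto
    have "\<psi> \<one> \<in> Idl (Q \<union> \<psi> ` carrier R)" using genideal_self[OF sub] by blast
    then show ?thesis using ideal.one_imp_carrier[OF genideal_ideal[OF sub]] by simp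
  qed
  ultimately show ?case by (simp add: length_le_refl)
qed

lemma length_le_m: "length_le R m (carrier R) 1"
  unfolding length_le_def chain_between_def
proof (intro allI impI, elim exE conjE, rule ccontr)
  fix k F assume F: "F 0 = m" "F k = carrier R" "\<forall>i\<le>k. ideal (F i) R"
    "\<forall>i<k. F i \<subset> F (Suc i)" and k: "\<not> k \<le> 1"
  have "ideal (F 1) R" "ideal (F 2) R" "m \<subset> F 1" "F 1 \<subset> F 2"
    using F(1) F(3)[rule_format, of 1] F(3)[rule_format, of 2] F(4)[rule_format, of 0]
      F(4)[rule_format, of 1] k by (auto simp: numeral_2_eq_2)
  then have "F 1 \<subseteq> m"
    using ideal_subset_carrier[of "F 2" R] by (intro proper_ideal_subset_m) auto
  then show False using \<open>m \<subset> F 1\<close> by blast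
qed

text \<open>Modulo \<open>P\<close>, an integral equation of \<open>x \<in> m\<close> has its constant coefficient in \<open>\<phi>(m)\<close>, because \<open>\<phi>\<close> maps
  units to units; so its degree can be lowered as long as \<open>x \<notin> P\<close>.\<close>
lemma prime_over_image_of_m:
  assumes phi: "\<phi> \<in> ring_hom R R" and intg: "integral_self_map R \<phi>"
    and P: "primeideal P R" "\<phi> ` m \<subseteq> P"
  shows "P = m"
proof
  interpret P: primeideal P R by fact
  interpret phi: ring_hom_ring R R \<phi>
    using phi by (intro ring_hom_ringI2 ring_axioms)
  show Pm: "P \<subseteq> m" using P.I_notcarr by (intro proper_ideal_subset_m P.is_ideal) auto
  show "m \<subseteq> P"
  proof (rule subsetI, rule ccontr)
    fix x assume x: "x \<in> m" "x \<notin> P"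
    have xc: "x \<in> carrier R" using x(1) m_subset by blast
    \<comment> \<open>Monic relations are taken modulo \<open>P\<close>, not as equations:
      cancelling a factor \<open>x\<close> preserves a relation only modulo the prime
      \<open>P\<close>.\<close>
    have no_relation: False if "\<forall>i<d. c i \<in> \<phi> ` carrier R"
      "x [^] d \<oplus> finsum R (\<lambda>i. c i \<otimes> x [^] i) {..<d} \<in> P" for d :: nat and c :: "nat \<Rightarrow> 'a"
      using that
    proof (induction d arbitrary: c)
      case 0
      then have "\<one> \<in> P" by simp
      then show False using Pm one_notin_m by blast
    next
      case (Suc d)
      have cc: "c i \<in> carrier R" if "i < Suc d" for i using Suc.prems(1) that by auto
      \<comment> \<open>The relation reads \<open>s x + c 0\<close>, where \<open>s\<close> is a
        monic expression of degree one less.\<close>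
      define s where "s = x [^] d \<oplus> finsum R (\<lambda>i. c (Suc i) \<otimes> x [^] i) {..<d}"
      have terms: "(\<lambda>i. c (Suc i) \<otimes> x [^] i) \<in> {..<d} \<rightarrow> carrier R" using cc xc by auto
      have sc: "s \<in> carrier R" unfolding s_def using terms xc by simp
      have c0: "c 0 \<in> carrier R" using cc by simp
      have "finsum R (\<lambda>i. c i \<otimes> x [^] i) {..<Suc d}
          = finsum R (\<lambda>i. c (Suc i) \<otimes> x [^] Suc i) {..<d} \<oplus> c 0"
      proof -
        have "{..<Suc d} = insert 0 (Suc ` {..<d})" by (rule lessThan_Suc_eq_insert_0)
        moreover have "finsum R (\<lambda>i. c i \<otimes> x [^] i) (insert 0 (Suc ` {..<d}))
            = c 0 \<otimes> x [^] (0::nat) \<oplus> finsum R (\<lambda>i. c i \<otimes> x [^] i) (Suc ` {..<d})"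
          using cc xc by (intro finsum_insert) auto
        moreover have "finsum R (\<lambda>i. c i \<otimes> x [^] i) (Suc ` {..<d})
            = finsum R (\<lambda>i. c (Suc i) \<otimes> x [^] Suc i) {..<d}"
          using cc xc by (intro finsum_reindex) auto
        moreover have "finsum R (\<lambda>i. c (Suc i) \<otimes> x [^] Suc i) {..<d} \<in> carrier R"
          using cc xc by (intro finsum_closed) auto
        ultimately show ?thesis using c0 by (simp add: a_comm)
      qed
      also have "finsum R (\<lambda>i. c (Suc i) \<otimes> x [^] Suc i) {..<d}
          = finsum R (\<lambda>i. c (Suc i) \<otimes> x [^] i) {..<d} \<otimes> x"
        unfolding finsum_ldistr[OF finite_lessThan xc terms]
        using cc xc by (intro finsum_cong') (auto simp: m_assoc)
      finally have eq: "x [^] Suc d \<oplus> finsum R (\<lambda>i. c i \<otimes> x [^] i) {..<Suc d} = s \<otimes> x \<oplus> c 0"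
        unfolding s_def using finsum_closed[OF terms] xc c0 by (simp add: l_distr a_assoc)
      have sxP: "s \<otimes> x \<oplus> c 0 \<in> P" using Suc.prems(2) unfolding eq .
      have sxm: "s \<otimes> x \<in> m" using x(1) sc by (rule ideal.I_l_closed[OF m_ideal])
      obtain r where r: "r \<in> carrier R" "c 0 = \<phi> r" using Suc.prems(1) by auto
      have "c 0 = (s \<otimes> x \<oplus> c 0) \<ominus> s \<otimes> x" using sc xc c0 by algebra
      moreover have "(s \<otimes> x \<oplus> c 0) \<ominus> s \<otimes> x \<in> m"
      proof -
        interpret m: ideal m R by (rule m_ideal)
        show ?thesis using sxP Pm sxm by (simp add: minus_eq subsetD)
      qed
      ultimately have c0m: "c 0 \<in> m" by simp
      \<comment> \<open>If \<open>r\<close> were a unit, so would be \<open>c 0 = \<phi> r\<close>;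
        but \<open>c 0\<close> is a difference of elements of \<open>m\<close>.\<close>
      have "r \<in> m"
      proof (rule ccontr)
        assume "r \<notin> m"
        then obtain y where y: "y \<in> carrier R" "r \<otimes> y = \<one>"
          using right_inverse_of_not_mem_m[OF r(1)] by blast
        have "\<phi> r \<otimes> \<phi> y = \<one>" using y r(1) by (metis phi.hom_mult phi.hom_one)
        then have "\<one> \<in> m" using ideal.I_r_closed[OF m_ideal c0m, of "\<phi> y"] r(2) y(1) by simp
        then show False using one_notin_m by simp
      qed
      then have "c 0 \<in> P" using P(2) r(2) by blast
      then have "(s \<otimes> x \<oplus> c 0) \<ominus> c 0 \<in> P" using sxP by (simp add: minus_eq)
      moreover have "(s \<otimes> x \<oplus> c 0) \<ominus> c 0 = s \<otimes> x" using sc xc c0 by algebra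
      ultimately have "s \<in> P" using P.I_prime[OF sc xc] x(2) by simp
      then show False using Suc.IH[of "\<lambda>i. c (Suc i)"] Suc.prems(1) unfolding s_def by simp
    qed
    obtain d c where "\<forall>i<d. c i \<in> \<phi> ` carrier R"
      "x [^] (d::nat) \<oplus> finsum R (\<lambda>i. c i \<otimes> x [^] i) {..<d} = \<zero>"
      using intg xc unfolding integral_self_map_def by blast
    then show False using no_relation[of d c] by simp
  qed
qed

text \<open>Colon induction: the only prime that can occur is \<open>m\<close>, whose residue ring
  has length at most 1, and each induction step adds two bounds.\<close>

lemma finite_length_over_image_of_m:
  assumes phi: "\<phi> \<in> ring_hom R R" and intg: "integral_self_map R \<phi>"
  shows "\<exists>b. length_le R (Idl (\<phi> ` m)) (carrier R) b"
proof -
  have sub: "\<phi> ` m \<subseteq> carrier R"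
    using phi m_subset by (auto simp: ring_hom_def)
  show ?thesis
  proof (rule noetherian_colon_induct[OF genideal_ideal[OF sub]])
    show "\<exists>b. length_le R (carrier R) (carrier R) b" using length_le_refl by blast
    show "\<exists>b. length_le R P (carrier R) b" if P: "primeideal P R" "Idl (\<phi> ` m) \<subseteq> P" for P
    proof -
      have "P = m"
        using prime_over_image_of_m[OF phi intg P(1)] genideal_self[OF sub] P(2) by simp
      then show ?thesis using length_le_m by blast
    qed
    fix I a
    assume I: "ideal I R" and a: "a \<in> carrier R"
      and b1: "\<exists>b. length_le R (Idl (insert a I)) (carrier R) b"
      and b2: "\<exists>b. length_le R {r \<in> carrier R. a \<otimes> r \<in> I} (carrier R) b"
    obtain b b' where "length_le R (Idl (insert a I)) (carrier R) b"
      "length_le R {r \<in> carrier R. a \<otimes> r \<in> I} (carrier R) b'" using b1 b2 by auto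
    then have "length_le R I (carrier R) (b' + b)"
      by (intro length_le_cyclic_step[OF I a ideal.helper_max_prime[OF I is_cring a]]) auto
    then show "\<exists>b. length_le R I (carrier R) b" by blast
  qed
qed

end

text \<open>Finite length of \<open>R/\<psi>(m)R\<close> replaces the condition that
  \<open>\<psi>(m)R\<close> be \<open>m\<close>-primary; over a Noetherian local ring the two are
  equivalent.\<close>

locale finite_length_self_map = noetherian_local_ring R m for R (structure) and m +
  fixes \<psi>
  assumes hom: "\<psi> \<in> ring_hom R R"
    and m_stable: "\<psi> ` m \<subseteq> m"
    and finite_length: "\<exists>b. length_le R (Idl (\<psi> ` m)) (carrier R) b"
begin

text \<open>For a \<open>\<psi>\<close>-stable ideal \<open>Q\<close> inside \<open>m\<close>, this
  is the preimage in \<open>R\<close> of the extended ideal whose colength in \<open>R/Q\<close> is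
  \<open>\<lambda>\<close> of the induced map. Since \<open>Q\<close> is any set,
  \<open>Q = {}\<close> covers \<open>R\<close> itself.\<close>

definition ext_ideal :: "'a set \<Rightarrow> nat \<Rightarrow> 'a set" where
  "ext_ideal Q k = Idl (Q \<union> (\<psi> ^^ k) ` m)"

definition ext_length :: "'a set \<Rightarrow> nat \<Rightarrow> nat" where
  "ext_length Q k = quot_length R (ext_ideal Q k)"

lemma pow_hom: "\<psi> ^^ k \<in> ring_hom R R"
  by (rule funpow_ring_hom[OF hom])

lemma pow_image_subset: "S \<subseteq> carrier R \<Longrightarrow> (\<psi> ^^ k) ` S \<subseteq> carrier R"
  using ring_hom_closed[OF pow_hom] by auto

lemma pow_m_subset: "(\<psi> ^^ k) ` m \<subseteq> m"
  by (rule funpow_image_subset[OF m_stable])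

lemma ext_gens_subset:
  assumes "Q \<subseteq> carrier R"
  shows "Q \<union> (\<psi> ^^ k) ` m \<subseteq> carrier R"
  using assms pow_image_subset[OF m_subset] by simp

lemma ext_ideal_ideal: "Q \<subseteq> carrier R \<Longrightarrow> ideal (ext_ideal Q k) R"
  unfolding ext_ideal_def by (intro genideal_ideal ext_gens_subset)

lemma ext_ideal_self:
  assumes "Q \<subseteq> carrier R"
  shows "Q \<subseteq> ext_ideal Q k" "(\<psi> ^^ k) ` m \<subseteq> ext_ideal Q k"
  using genideal_self[OF ext_gens_subset[OF assms]] unfolding ext_ideal_def by auto

lemma ext_ideal_least:
  "ideal T R \<Longrightarrow> Q \<subseteq> T \<Longrightarrow> (\<psi> ^^ k) ` m \<subseteq> T \<Longrightarrow> ext_ideal Q k \<subseteq> T"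
  unfolding ext_ideal_def by (intro genideal_minimal) auto

lemma finite_length_pow: "\<exists>c. length_le R (ext_ideal {} k) (carrier R) c"
proof (induction k)
  case 0
  have "m \<subseteq> ext_ideal {} 0" using ext_ideal_self(2)[of "{}" 0] by simp
  then show ?case using length_le_antimono[OF length_le_m m_ideal] by blast
next
  case (Suc k)
  then obtain c where c: "length_le R (ext_ideal {} k) (carrier R) c" by blast
  obtain b where b: "length_le R (Idl (\<psi> ` m)) (carrier R) b" using finite_length by blast
  have I: "ideal (ext_ideal {} k) R" by (rule ext_ideal_ideal) simp
  have "length_le R (Idl ({} \<union> \<psi> ` ext_ideal {} k)) (carrier R) (c * b)"
    using b by (intro length_le_extension[OF hom _ _ I c]) auto
  moreover have "ideal (Idl ({} \<union> \<psi> ` ext_ideal {} k)) R"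
    using ring_hom_closed[OF hom] ideal_subset_carrier[OF I] by (intro genideal_ideal) auto
  moreover have "Idl ({} \<union> \<psi> ` ext_ideal {} k) \<subseteq> ext_ideal {} (Suc k)"
  proof (rule genideal_minimal)
    show T: "ideal (ext_ideal {} (Suc k)) R" by (rule ext_ideal_ideal) simp
    have "\<psi> ` ((\<psi> ^^ k) ` m) \<subseteq> ext_ideal {} (Suc k)"
      using ext_ideal_self(2)[of "{}" "Suc k"] by (simp add: image_image)
    then have "\<psi> ` (Idl ({} \<union> (\<psi> ^^ k) ` m)) \<subseteq> ext_ideal {} (Suc k)"
      using pow_image_subset[OF m_subset] by (intro image_genideal_subset[OF hom T]) auto
    then show "{} \<union> \<psi> ` ext_ideal {} k \<subseteq> ext_ideal {} (Suc k)"
      unfolding ext_ideal_def[of "{}" k] by simp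
  qed
  ultimately show ?case using length_le_antimono by blast
qed

lemma ext_ideal_mono:
  assumes "Q \<subseteq> Q'" "Q' \<subseteq> carrier R"
  shows "ext_ideal Q k \<subseteq> ext_ideal Q' k"
  using assms ext_ideal_self[OF assms(2)] by (intro ext_ideal_least ext_ideal_ideal) blast+

lemma length_le_ext_length:
  assumes Q: "Q \<subseteq> carrier R"
  shows "length_le R (ext_ideal Q k) (carrier R) (ext_length Q k)"
proof -
  obtain c where "length_le R (ext_ideal {} k) (carrier R) c" using finite_length_pow by blast
  then have "length_le R (ext_ideal Q k) (carrier R) c"
    by (rule length_le_antimono) (use ext_ideal_ideal[of "{}"] ext_ideal_mono[of "{}" Q] Q in auto)
  then show ?thesis
    unfolding ext_length_def by (rule length_le_quot_length[OF ext_ideal_ideal[OF Q]])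
qed

lemma ext_length_antimono:
  assumes "Q \<subseteq> Q'" "Q' \<subseteq> carrier R"
  shows "ext_length Q' k \<le> ext_length Q k"
  unfolding ext_length_def[of Q']
proof (rule quot_length_le)
  have Q: "Q \<subseteq> carrier R" using assms by blast
  show "ideal (ext_ideal Q' k) R" by (rule ext_ideal_ideal[OF assms(2)])
  show "length_le R (ext_ideal Q' k) (carrier R) (ext_length Q k)"
    by (rule length_le_antimono[OF length_le_ext_length[OF Q] ext_ideal_ideal[OF Q] ext_ideal_mono[OF assms]])
qed

lemma ext_length_ge_1:
  assumes "Q \<subseteq> m"
  shows "1 \<le> ext_length Q k"
proof -
  have Q: "Q \<subseteq> carrier R" using assms m_subset by blast
  have "ext_ideal Q k \<subseteq> m" using assms pow_m_subset by (intro ext_ideal_least m_ideal)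
  then have "ext_ideal Q k \<noteq> carrier R" using one_notin_m by blast
  then show ?thesis
    unfolding ext_length_def
    by (rule quot_length_ge_1[OF ext_ideal_ideal[OF Q] length_le_ext_length[OF Q]])
qed

text \<open>Extending \<open>Q + \<psi>^i(m)R\<close> along \<open>\<psi>^j\<close> stays inside
  \<open>Q + \<psi>^(i+j)(m)R\<close> once \<open>Q\<close> is added, because \<open>Q\<close> is
  stable; \<open>length_le_extension\<close> bounds the resulting length by the product.\<close>

lemma ext_length_submultiplicative:
  assumes Q: "Q \<subseteq> carrier R" "\<psi> ` Q \<subseteq> Q"
  shows "ext_length Q (i + j) \<le> ext_length Q i * ext_length Q j"
  unfolding ext_length_def[of Q "i + j"]
proof (rule quot_length_le)
  show T: "ideal (ext_ideal Q (i + j)) R" by (rule ext_ideal_ideal[OF Q(1)])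
  note I = ext_ideal_ideal[OF Q(1), of i]
  have "length_le R (Idl (Q \<union> (\<psi> ^^ j) ` ext_ideal Q i)) (carrier R) (ext_length Q i * ext_length Q j)"
    using length_le_ext_length[OF Q(1), of j]
    unfolding ext_ideal_def[of Q j]
    by (intro length_le_extension[OF pow_hom Q(1) _ I] length_le_ext_length[OF Q(1)])
  moreover have "ideal (Idl (Q \<union> (\<psi> ^^ j) ` ext_ideal Q i)) R"
    using Q pow_image_subset[OF ideal_subset_carrier[OF I]] by (intro genideal_ideal) auto
  moreover have "Idl (Q \<union> (\<psi> ^^ j) ` ext_ideal Q i) \<subseteq> ext_ideal Q (i + j)"
  proof (rule genideal_minimal[OF T])
    note self = ext_ideal_self[OF Q(1), of "i + j"]
    have "(\<psi> ^^ j) ` ((\<psi> ^^ i) ` m) \<subseteq> ext_ideal Q (i + j)"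
      using self(2) by (simp add: image_comp funpow_add[symmetric] add.commute)
    moreover have "(\<psi> ^^ j) ` Q \<subseteq> ext_ideal Q (i + j)"
      using funpow_image_subset[OF Q(2), of j] self(1) by blast
    ultimately have "(\<psi> ^^ j) ` (Idl (Q \<union> (\<psi> ^^ i) ` m)) \<subseteq> ext_ideal Q (i + j)"
      using ext_gens_subset[OF Q(1)] by (intro image_genideal_subset[OF pow_hom T]) (auto simp: image_Un)
    then show "Q \<union> (\<psi> ^^ j) ` ext_ideal Q i \<subseteq> ext_ideal Q (i + j)"
      using self(1) unfolding ext_ideal_def[of Q i] by blast
  qed
  ultimately show "length_le R (ext_ideal Q (i + j)) (carrier R) (ext_length Q i * ext_length Q j)"
    by (rule length_le_antimono)
qed

lemma ext_length_growth_limit: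
  assumes "Q \<subseteq> m" "\<psi> ` Q \<subseteq> Q"
  shows "(\<lambda>n. ln (real (ext_length Q n)) / real n) \<longlonglongrightarrow> lim (\<lambda>n. ln (real (ext_length Q n)) / real n)"
  using assms m_subset
  by (intro submultiplicative_growth_limit ext_length_ge_1 ext_length_submultiplicative) auto

lemma minimal_prime_subset_m:
  assumes "P \<in> minimal_primes_over R K"
  shows "P \<subseteq> m"
proof -
  have P: "primeideal P R" using assms unfolding minimal_primes_over_def by simp
  show ?thesis
    using primeideal.I_notcarr[OF P] by (intro proper_ideal_subset_m primeideal.axioms(1)[OF P]) auto
qed

text \<open>The induction runs over the extension of \<open>J + \<psi>\<^sup>k(m)R\<close> along \<open>\<psi>\<^sup>n\<close>, for ideals \<open>J\<close> containing \<open>K\<close>; as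
  \<open>\<psi>\<^sup>n\<close> kills \<open>K\<close>, the case \<open>J = K\<close> is \<open>\<psi>\<^bsup>n+k\<^esup>(m)R\<close>.\<close>
lemma ext_length_le_sum_minimal_primes:
  assumes K: "ideal K R" and kill: "\<And>x. x \<in> K \<Longrightarrow> (\<psi> ^^ n) x = \<zero>"
  shows "\<exists>C. \<forall>k. ext_length {} (n + k) \<le> C * (\<Sum>P\<in>minimal_primes_over R K. ext_length P k)"
proof -
  \<comment> \<open>The second factor is the cost of extending along \<open>\<psi>^n\<close>; it
    does not depend on \<open>k\<close> and joins the constant at the end.\<close>
  define B where "B k = (\<Sum>P\<in>minimal_primes_over R K. ext_length P k) * ext_length {} n" for k
  define U where "U J k = Idl ((\<psi> ^^ n) ` ext_ideal J k)" for J k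
  have imgU: "(\<psi> ^^ n) ` ext_ideal J k \<subseteq> carrier R" if "J \<subseteq> carrier R" for J k
    by (rule pow_image_subset[OF ideal_subset_carrier[OF ext_ideal_ideal[OF that]]])
  have U: "ideal (U J k) R" "(\<psi> ^^ n) ` ext_ideal J k \<subseteq> U J k" if "J \<subseteq> carrier R" for J k
    using genideal_ideal[OF imgU[OF that]] genideal_self[OF imgU[OF that]] unfolding U_def by auto
  have U_least: "U J k \<subseteq> T"
    if "ideal T R" "J \<subseteq> carrier R" "(\<psi> ^^ n) ` J \<subseteq> T" "(\<psi> ^^ n) ` ((\<psi> ^^ k) ` m) \<subseteq> T" for J k T
  proof -
    have "(\<psi> ^^ n) ` (Idl (J \<union> (\<psi> ^^ k) ` m)) \<subseteq> T"
      using that ext_gens_subset[OF that(2)]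
      by (intro image_genideal_subset[OF pow_hom that(1)]) (auto simp: image_Un)
    then show ?thesis
      unfolding U_def using that(1) by (intro genideal_minimal) (auto simp: ext_ideal_def)
  qed
  have bound: "length_le R (U J k) (carrier R) (a * ext_length {} n)"
    if "J \<subseteq> carrier R" "length_le R (ext_ideal J k) (carrier R) a" for J k a
  proof -
    have "length_le R (Idl ({} \<union> (\<psi> ^^ n) ` ext_ideal J k)) (carrier R) (a * ext_length {} n)"
      using length_le_ext_length[of "{}" n]
      by (intro length_le_extension[OF pow_hom _ _ ext_ideal_ideal[OF that(1)] that(2)])
        (auto simp: ext_ideal_def)
    then show ?thesis by (simp add: U_def)
  qed
  \<comment> \<open>The order of the quantifiers matters: \<open>C\<close> counts the steps of a
    filtration of \<open>R/K\<close> and must serve all \<open>k\<close> at once.\<close>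
  have "\<exists>C. \<forall>k. length_le R (U K k) (carrier R) (C * B k)"
  proof (rule noetherian_colon_induct[OF K])
    have "length_le R (U (carrier R) k) (carrier R) (0 * B k)" for k
    proof -
      have "length_le R (ext_ideal (carrier R) k) (carrier R) 0"
        using ext_ideal_self(1)[of "carrier R" k]
        by (intro length_le_antimono[OF length_le_refl oneideal]) auto
      then show ?thesis using bound[of "carrier R" k 0] by simp
    qed
    then show "\<exists>C. \<forall>k. length_le R (U (carrier R) k) (carrier R) (C * B k)" by blast
  next
    fix P assume P: "primeideal P R" "K \<subseteq> P"
    have Pc: "P \<subseteq> carrier R" by (rule ideal_subset_carrier[OF primeideal.axioms(1)[OF P(1)]])
    obtain Q where Q: "Q \<in> minimal_primes_over R K" "Q \<subseteq> P"
      using minimal_prime_below[OF K P] by blast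
    have Qc: "Q \<subseteq> carrier R" using Q(2) Pc by blast
    \<comment> \<open>A prime costs one unit: enlarging the minimal prime \<open>Q\<close> below
      \<open>P\<close> to \<open>P\<close> can only shorten the length, and the sum dominates the
      summand of \<open>Q\<close>.\<close>
    have "length_le R (U P k) (carrier R) (1 * B k)" for k
    proof -
      have "length_le R (ext_ideal P k) (carrier R) (ext_length Q k)"
        by (rule length_le_antimono[OF length_le_ext_length[OF Qc] ext_ideal_ideal[OF Qc] ext_ideal_mono[OF Q(2) Pc]])
      then have "length_le R (U P k) (carrier R) (ext_length Q k * ext_length {} n)"
        by (rule bound[OF Pc])
      moreover have "ext_length Q k \<le> (\<Sum>P\<in>minimal_primes_over R K. ext_length P k)"
        using Q(1) by (intro member_le_sum finite_minimal_primes_over[OF K]) auto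
      ultimately show ?thesis
        unfolding B_def by (elim length_le_mono) simp
    qed
    then show "\<exists>C. \<forall>k. length_le R (U P k) (carrier R) (C * B k)" by blast
  next
    fix I a assume I: "ideal I R" and a: "a \<in> carrier R"
      and "\<exists>C. \<forall>k. length_le R (U (Idl (insert a I)) k) (carrier R) (C * B k)"
      and "\<exists>C. \<forall>k. length_le R (U {r \<in> carrier R. a \<otimes> r \<in> I} k) (carrier R) (C * B k)"
    then obtain C1 C2 where C1: "\<And>k. length_le R (U (Idl (insert a I)) k) (carrier R) (C1 * B k)"
      and C2: "\<And>k. length_le R (U {r \<in> carrier R. a \<otimes> r \<in> I} k) (carrier R) (C2 * B k)"
      by auto
    interpret pown: ring_hom_ring R R "\<psi> ^^ n"
      using pow_hom by (intro ring_hom_ringI2 ring_axioms)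
    note Ic = ideal_subset_carrier[OF I] and ins = genideal_insert[OF I a]
    have colon_c: "{r \<in> carrier R. a \<otimes> r \<in> I} \<subseteq> carrier R" by blast
    have ins_c: "Idl (insert a I) \<subseteq> carrier R" by (rule ideal_subset_carrier[OF ins(1)])
    have fa: "(\<psi> ^^ n) a \<in> carrier R" using a by simp
    \<comment> \<open>Multiplication by \<open>\<psi>^n(a)\<close> carries
      \<open>U (I : a) k\<close> into \<open>U I k\<close>, since \<open>a (I : a)\<close> lies in
      \<open>I\<close>. The two filtrations are therefore stacked and their constants add
      up.\<close>
    have "length_le R (U I k) (carrier R) (C2 * B k + C1 * B k)" for k
    proof (rule length_le_cyclic_step[OF U(1)[OF Ic] fa U(1)[OF colon_c] _ C2])
      have fI: "(\<psi> ^^ n) ` I \<subseteq> U I k" and fT: "(\<psi> ^^ n) ` ((\<psi> ^^ k) ` m) \<subseteq> U I k"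
        using U(2)[OF Ic, of k] ext_ideal_self[OF Ic, of k] by blast+
      note X = genideal_insert[OF U(1)[OF Ic, of k] fa]
      have "U (Idl (insert a I)) k \<subseteq> Idl (insert ((\<psi> ^^ n) a) (U I k))"
      proof (rule U_least[OF X(1) ins_c])
        show "(\<psi> ^^ n) ` (Idl (insert a I)) \<subseteq> Idl (insert ((\<psi> ^^ n) a) (U I k))"
          using a Ic X(2,3) fI by (intro image_genideal_subset[OF pow_hom X(1)]) auto
        show "(\<psi> ^^ n) ` ((\<psi> ^^ k) ` m) \<subseteq> Idl (insert ((\<psi> ^^ n) a) (U I k))"
          using fT X(3) by blast
      qed
      then show "length_le R (Idl (insert ((\<psi> ^^ n) a) (U I k))) (carrier R) (C1 * B k)"
        by (rule length_le_antimono[OF C1 U(1)[OF ins_c]])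
      fix d assume d: "d \<in> U {r \<in> carrier R. a \<otimes> r \<in> I} k"
      have "U {r \<in> carrier R. a \<otimes> r \<in> I} k \<subseteq> {r \<in> carrier R. (\<psi> ^^ n) a \<otimes> r \<in> U I k}"
      proof (rule U_least[OF _ colon_c])
        show "ideal {r \<in> carrier R. (\<psi> ^^ n) a \<otimes> r \<in> U I k} R"
          by (rule ideal.helper_max_prime[OF U(1)[OF Ic] is_cring fa])
        have "(\<psi> ^^ n) a \<otimes> (\<psi> ^^ n) r \<in> U I k" if "r \<in> carrier R" "a \<otimes> r \<in> I" for r
        proof -
          have "(\<psi> ^^ n) (a \<otimes> r) \<in> U I k" using fI that(2) by blast
          then show ?thesis using a that(1) by simp
        qed
        then show "(\<psi> ^^ n) ` {r \<in> carrier R. a \<otimes> r \<in> I} \<subseteq> {r \<in> carrier R. (\<psi> ^^ n) a \<otimes> r \<in> U I k}"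
          by auto
        have "(\<psi> ^^ n) ` ((\<psi> ^^ k) ` m) \<subseteq> carrier R"
          by (intro pow_image_subset m_subset)
        moreover have "(\<psi> ^^ n) a \<otimes> t \<in> U I k" if "t \<in> (\<psi> ^^ n) ` ((\<psi> ^^ k) ` m)" for t
          by (rule ideal.I_l_closed[OF U(1)[OF Ic] subsetD[OF fT that] fa])
        ultimately show "(\<psi> ^^ n) ` ((\<psi> ^^ k) ` m) \<subseteq> {r \<in> carrier R. (\<psi> ^^ n) a \<otimes> r \<in> U I k}"
          by blast
      qed
      then show "(\<psi> ^^ n) a \<otimes> d \<in> U I k" using d by blast
    qed
    then have "\<forall>k. length_le R (U I k) (carrier R) ((C2 + C1) * B k)"
      by (simp add: add_mult_distrib)
    then show "\<exists>C. \<forall>k. length_le R (U I k) (carrier R) (C * B k)" by blast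
  qed
  then obtain C where C: "\<And>k. length_le R (U K k) (carrier R) (C * B k)" by blast
  note Kc = ideal_subset_carrier[OF K]
  have "ext_length {} (n + k) \<le> C * B k" for k
    unfolding ext_length_def
  proof (rule quot_length_le)
    show T: "ideal (ext_ideal {} (n + k)) R" by (rule ext_ideal_ideal) simp
    \<comment> \<open>Because \<open>\<psi>^n\<close> annihilates \<open>K\<close>, only the powers
      of \<open>m\<close> survive in \<open>U K k\<close>.\<close>
    have "(\<psi> ^^ n) ` K \<subseteq> ext_ideal {} (n + k)"
      using kill additive_subgroup.zero_closed[OF ideal.axioms(1)[OF T]] by auto
    moreover have "(\<psi> ^^ n) ` ((\<psi> ^^ k) ` m) \<subseteq> ext_ideal {} (n + k)"
      using ext_ideal_self(2)[of "{}" "n + k"] by (simp add: image_comp funpow_add[symmetric])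
    ultimately have "U K k \<subseteq> ext_ideal {} (n + k)" by (intro U_least[OF T Kc])
    then show "length_le R (ext_ideal {} (n + k)) (carrier R) (C * B k)"
      by (rule length_le_antimono[OF C U(1)[OF Kc]])
  qed
  then have "\<forall>k. ext_length {} (n + k)
      \<le> (C * ext_length {} n) * (\<Sum>P\<in>minimal_primes_over R K. ext_length P k)"
    unfolding B_def by (simp add: mult_ac)
  then show ?thesis by blast
qed

lemma lam_eq_ext_length: "lam R \<psi> k = ext_length {} k"
  by (simp add: lam_def ext_length_def ext_ideal_def loc_max_eq)

end

lemma (in noetherian_local_ring) finite_length_self_map_pow:
  assumes "finite_length_self_map R m \<phi>"
  shows "finite_length_self_map R m (\<phi> ^^ p)"
proof -
  interpret phi: finite_length_self_map R m \<phi> by fact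
  show ?thesis
  proof
    show "\<phi> ^^ p \<in> ring_hom R R" by (rule phi.pow_hom)
    show "(\<phi> ^^ p) ` m \<subseteq> m" by (rule phi.pow_m_subset)
    show "\<exists>b. length_le R (Idl ((\<phi> ^^ p) ` m)) (carrier R) b"
      using phi.finite_length_pow[of p] by (simp add: phi.ext_ideal_def)
  qed
qed

section \<open>Quotient rings\<close>

context ring
begin

lemma carrier_quot: "carrier (R Quot I) = (+>) I ` carrier R"
  by (auto simp: FactRing_def A_RCOSETS_def')

lemma rcos_mem_image_iff:
  assumes I: "ideal I R" and J: "ideal J R" "I \<subseteq> J" and x: "x \<in> carrier R"
  shows "I +> x \<in> (+>) I ` J \<longleftrightarrow> x \<in> J"
proof -
  have "(+>) I ` J \<subseteq> carrier (R Quot I)"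
    unfolding carrier_quot using ideal_subset_carrier[OF J(1)] by blast
  then have "x \<in> \<Union> ((+>) I ` J) \<longleftrightarrow> I +> x \<in> (+>) I ` J"
    by (rule canonical_proj_vimage_mem_iff[OF I _ x])
  moreover have "\<Union> ((+>) I ` J) = J"
    using ideal_incl_iff[OF I J(1)] J(2) by simp
  ultimately show ?thesis by simp
qed

lemma rcos_image_subset_iff:
  assumes I: "ideal I R" and J: "ideal J R" "I \<subseteq> J" and J': "ideal J' R" "I \<subseteq> J'"
  shows "(+>) I ` J \<subseteq> (+>) I ` J' \<longleftrightarrow> J \<subseteq> J'"
proof
  assume sub: "(+>) I ` J \<subseteq> (+>) I ` J'"
  show "J \<subseteq> J'"
  proof
    fix x assume x: "x \<in> J"
    then have "x \<in> carrier R" using ideal_subset_carrier[OF J(1)] by blast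
    then show "x \<in> J'" using rcos_mem_image_iff[OF I J'] sub x by blast
  qed
qed blast

lemma rcos_image_eq_iff:
  assumes I: "ideal I R" and J: "ideal J R" "I \<subseteq> J" and J': "ideal J' R" "I \<subseteq> J'"
  shows "(+>) I ` J = (+>) I ` J' \<longleftrightarrow> J = J'"
  using rcos_image_subset_iff[OF I J J'] rcos_image_subset_iff[OF I J' J] by (metis set_eq_subset)

lemma quot_ideal_obtain:
  assumes I: "ideal I R" and Y: "ideal Y (R Quot I)"
  obtains J where "ideal J R" "I \<subseteq> J" "Y = (+>) I ` J"
proof -
  have "Y \<in> (\<lambda>J. (+>) I ` J) ` {J. ideal J R \<and> I \<subseteq> J}"
    using bij_betw_imp_surj_on[OF quot_ideal_correspondence[OF I]] Y by simp
  then show ?thesis using that by auto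
qed

text \<open>The correspondence of ideals preserves and reflects inclusion, so strict chains above
  \<open>I\<close> and in \<open>R Quot I\<close> match step by step.\<close>

lemma ideal_chain_quot:
  assumes I: "ideal I R" and J: "ideal J R" "I \<subseteq> J"
  shows "ideal_chain (R Quot I) ((+>) I ` J) k \<longleftrightarrow> ideal_chain R J k"
proof
  assume "ideal_chain R J k"
  then obtain F where F: "F 0 = J" "F k = carrier R" "\<And>i. i \<le> k \<Longrightarrow> ideal (F i) R"
    "\<And>i. i < k \<Longrightarrow> F i \<subset> F (Suc i)" unfolding ideal_chain_def by auto
  have sub: "I \<subseteq> F i" if "i \<le> k" for i
    using that
  proof (induction i)
    case (Suc i)
    then show ?case using F(4)[of i] by auto
  qed (use F(1) J(2) in simp)
  have strict: "(+>) I ` F i \<subset> (+>) I ` F (Suc i)" if i: "i < k" for i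
  proof -
    have "ideal (F i) R" "I \<subseteq> F i" "ideal (F (Suc i)) R" "I \<subseteq> F (Suc i)"
      using F(3) sub i by auto
    then show ?thesis
      using F(4)[OF i] rcos_image_subset_iff[OF I] unfolding less_le_not_le by simp
  qed
  show "ideal_chain (R Quot I) ((+>) I ` J) k"
    unfolding ideal_chain_def carrier_quot
    using F strict ring_ideal_imp_quot_ideal[OF I] by (intro exI[of _ "\<lambda>i. (+>) I ` F i"]) auto
next
  assume "ideal_chain (R Quot I) ((+>) I ` J) k"
  then obtain G where G: "G 0 = (+>) I ` J" "G k = (+>) I ` carrier R"
    "\<And>i. i \<le> k \<Longrightarrow> ideal (G i) (R Quot I)" "\<And>i. i < k \<Longrightarrow> G i \<subset> G (Suc i)"
    unfolding ideal_chain_def carrier_quot by auto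
  define F where "F i = (SOME J. ideal J R \<and> I \<subseteq> J \<and> G i = (+>) I ` J)" for i
  have F: "ideal (F i) R \<and> I \<subseteq> F i \<and> G i = (+>) I ` F i" if "i \<le> k" for i
    unfolding F_def using quot_ideal_obtain[OF I G(3)[OF that]] by (rule someI_ex) blast
  have F0: "F 0 = J"
    using F[of 0] G(1) rcos_image_eq_iff[OF I _ _ J, of "F 0"] by simp
  have Fk: "F k = carrier R"
    using F[of k] G(2) rcos_image_eq_iff[OF I _ _ oneideal ideal_subset_carrier[OF I], of "F k"] by simp
  have strict: "F i \<subset> F (Suc i)" if i: "i < k" for i
  proof -
    have 1: "ideal (F i) R" "I \<subseteq> F i" "G i = (+>) I ` F i" using F[of i] i by auto
    have 2: "ideal (F (Suc i)) R" "I \<subseteq> F (Suc i)" "G (Suc i) = (+>) I ` F (Suc i)"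
      using F[of "Suc i"] i by auto
    show ?thesis
      using G(4)[OF i] rcos_image_subset_iff[OF I 1(1,2) 2(1,2)] rcos_image_subset_iff[OF I 2(1,2) 1(1,2)]
      unfolding less_le_not_le 1(3) 2(3) by simp
  qed
  show "ideal_chain R J k"
    unfolding ideal_chain_def using F0 Fk F strict by (intro exI[of _ F]) auto
qed

lemma quot_length_quot:
  assumes "ideal I R" "ideal J R" "I \<subseteq> J"
  shows "quot_length (R Quot I) ((+>) I ` J) = quot_length R J"
proof -
  have "{k. ideal_chain (R Quot I) ((+>) I ` J) k} = {k. ideal_chain R J k}"
    by (rule Collect_cong) (rule ideal_chain_quot[OF assms])
  then show ?thesis unfolding quot_length_def by (rule arg_cong)
qed

text \<open>\<open>quot_map\<close> unites the cosets of the images of all representatives.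
  Stability of \<open>I\<close> makes these cosets equal, and a coset is nonempty, so the union is
  that common coset.\<close>

lemma quot_map_rcos:
  assumes f: "f \<in> ring_hom R R" and I: "ideal I R" "f ` I \<subseteq> I" and x: "x \<in> carrier R"
  shows "quot_map R I f (I +> x) = I +> f x"
proof -
  interpret f: ring_hom_ring R R f
    using f by (intro ring_hom_ringI2 ring_axioms)
  interpret I: ideal I R by fact
  have const: "I +> f y = I +> f x" if "y \<in> I +> x" for y
  proof -
    obtain i where i: "i \<in> I" "y = i \<oplus> x" using \<open>y \<in> I +> x\<close> unfolding a_r_coset_def' by auto
    have ic: "i \<in> carrier R" and fi: "f i \<in> I" using i(1) I.Icarr I(2) by auto
    have fic: "f i \<in> carrier R" "f x \<in> carrier R" using ic x by simp_all
    have "f y \<ominus> f x = (f i \<oplus> f x) \<ominus> f x" using i(2) ic x by simp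
    also have "\<dots> = f i" using fic by (simp add: minus_eq a_assoc r_neg)
    finally have "f y \<ominus> f x \<in> I" using fi by simp
    moreover have "f y \<in> carrier R" using i(2) ic x by simp
    ultimately show ?thesis using quotient_eq_iff_same_a_r_cos[OF I(1)] fic(2) by blast
  qed
  have "\<zero> \<oplus> x \<in> I +> x" unfolding a_r_coset_def' using I.zero_closed by blast
  then have "I +> x \<noteq> {}" by blast
  then show ?thesis unfolding quot_map_def using const by (simp cong: SUP_cong)
qed

lemma quot_map_pow_rcos:
  assumes f: "f \<in> ring_hom R R" and I: "ideal I R" "f ` I \<subseteq> I" and x: "x \<in> carrier R"
  shows "(quot_map R I f ^^ k) (I +> x) = I +> (f ^^ k) x"
proof (induction k)
  case (Suc k)
  have "(f ^^ k) x \<in> carrier R" using ring_hom_closed[OF funpow_ring_hom[OF f] x] .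
  then show ?case using Suc quot_map_rcos[OF f I] by simp
qed simp

lemma spec_map_quot:
  assumes f: "f \<in> ring_hom R R" and I: "ideal I R" "f ` I \<subseteq> I" and P: "ideal P R" "I \<subseteq> P"
  shows "spec_map (R Quot I) (quot_map R I f) ((+>) I ` P) = (+>) I ` {x \<in> carrier R. f x \<in> P}"
proof -
  have "quot_map R I f (I +> x) \<in> (+>) I ` P \<longleftrightarrow> f x \<in> P" if "x \<in> carrier R" for x
    using quot_map_rcos[OF f I that] rcos_mem_image_iff[OF I(1) P ring_hom_closed[OF f that]] by simp
  then show ?thesis unfolding spec_map_def carrier_quot by auto
qed

lemma spec_map_pow_quot:
  assumes f: "f \<in> ring_hom R R" and I: "ideal I R" "f ` I \<subseteq> I" and P: "ideal P R" "I \<subseteq> P"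
  shows "(spec_map (R Quot I) (quot_map R I f) ^^ q) ((+>) I ` P)
    = (+>) I ` {x \<in> carrier R. (f ^^ q) x \<in> P}"
proof (induction q)
  case 0
  have "{x \<in> carrier R. (f ^^ 0) x \<in> P} = P" using ideal_subset_carrier[OF P(1)] by auto
  then show ?case by simp
next
  case (Suc q)
  interpret fq: ring_hom_ring R R "f ^^ q"
    using funpow_ring_hom[OF f] by (intro ring_hom_ringI2 ring_axioms)
  have "ideal {x \<in> carrier R. (f ^^ q) x \<in> P} R" by (rule fq.ideal_vimage[OF P(1)])
  moreover have "I \<subseteq> {x \<in> carrier R. (f ^^ q) x \<in> P}"
    using funpow_image_subset[OF I(2), of q] P(2) ideal_subset_carrier[OF I(1)] by blast
  ultimately have "spec_map (R Quot I) (quot_map R I f) ((+>) I ` {x \<in> carrier R. (f ^^ q) x \<in> P})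
      = (+>) I ` {x \<in> carrier R. f x \<in> {x \<in> carrier R. (f ^^ q) x \<in> P}}"
    by (rule spec_map_quot[OF f I])
  moreover have "{x \<in> carrier R. f x \<in> {x \<in> carrier R. (f ^^ q) x \<in> P}}
      = {x \<in> carrier R. (f ^^ Suc q) x \<in> P}"
    using ring_hom_closed[OF f] by (auto simp: funpow_swap1)
  ultimately show ?case using Suc by simp
qed

end

section \<open>Prime ideals of a quotient ring\<close>

context cring
begin

lemma primeideal_quot_iff:
  assumes I: "ideal I R" and P: "ideal P R" "I \<subseteq> P"
  shows "primeideal ((+>) I ` P) (R Quot I) \<longleftrightarrow> primeideal P R"
proof
  assume "primeideal ((+>) I ` P) (R Quot I)"
  then have "primeideal {r \<in> carrier R. I +> r \<in> (+>) I ` P} R"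
    by (rule ring_hom_ring.primeideal_vimage[OF ideal.rcos_ring_hom_ring[OF I] is_cring])
  moreover have "{r \<in> carrier R. I +> r \<in> (+>) I ` P} = P"
    using rcos_mem_image_iff[OF I P] ideal_subset_carrier[OF P(1)] by blast
  ultimately show "primeideal P R" by simp
next
  assume prime: "primeideal P R"
  interpret P: primeideal P R by (rule prime)
  show "primeideal ((+>) I ` P) (R Quot I)"
  proof (rule primeidealI)
    show "ideal ((+>) I ` P) (R Quot I)" by (rule ring_ideal_imp_quot_ideal[OF I P(1)])
    show "cring (R Quot I)" by (rule ideal.quotient_is_cring[OF I is_cring])
    show "carrier (R Quot I) \<noteq> (+>) I ` P"
      unfolding carrier_quot
      using rcos_image_eq_iff[OF I oneideal ideal_subset_carrier[OF I] P] P.I_notcarr by simp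
    fix a b assume "a \<in> carrier (R Quot I)" "b \<in> carrier (R Quot I)"
      and ab: "a \<otimes>\<^bsub>R Quot I\<^esub> b \<in> (+>) I ` P"
    then obtain x y where xy: "x \<in> carrier R" "y \<in> carrier R" "a = I +> x" "b = I +> y"
      unfolding carrier_quot by auto
    have "I +> (x \<otimes> y) = a \<otimes>\<^bsub>R Quot I\<^esub> b"
      using ring_hom_mult[OF ideal.rcos_ring_hom[OF I] xy(1,2)] xy(3,4) by simp
    then have "x \<otimes> y \<in> P" using ab rcos_mem_image_iff[OF I P, of "x \<otimes> y"] xy by simp
    then have "x \<in> P \<or> y \<in> P" by (rule P.I_prime[OF xy(1,2)])
    then show "a \<in> (+>) I ` P \<or> b \<in> (+>) I ` P" using xy(3,4) by blast
  qed
qed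

lemma rcos_image_in_Min_primes_iff:
  assumes I: "ideal I R" and P: "ideal P R" "I \<subseteq> P"
  shows "(+>) I ` P \<in> Min_primes (R Quot I) \<longleftrightarrow> P \<in> minimal_primes_over R I"
proof
  assume "(+>) I ` P \<in> Min_primes (R Quot I)"
  then have prime: "primeideal ((+>) I ` P) (R Quot I)"
    and min: "\<And>Y. primeideal Y (R Quot I) \<Longrightarrow> Y \<subseteq> (+>) I ` P \<Longrightarrow> Y = (+>) I ` P"
    unfolding Min_primes_def by auto
  have "Q = P" if Q: "primeideal Q R" "I \<subseteq> Q" "Q \<subseteq> P" for Q
  proof -
    note Qi = primeideal.axioms(1)[OF Q(1)]
    have "(+>) I ` Q = (+>) I ` P"
      using Q(1) primeideal_quot_iff[OF I Qi Q(2)] Q(3) by (intro min) auto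
    then show ?thesis using rcos_image_eq_iff[OF I Qi Q(2) P] by simp
  qed
  then show "P \<in> minimal_primes_over R I"
    unfolding minimal_primes_over_def using prime primeideal_quot_iff[OF I P] P(2) by blast
next
  assume "P \<in> minimal_primes_over R I"
  then have prime: "primeideal P R"
    and min: "\<And>Q. primeideal Q R \<Longrightarrow> I \<subseteq> Q \<Longrightarrow> Q \<subseteq> P \<Longrightarrow> Q = P"
    unfolding minimal_primes_over_def by auto
  have "Y = (+>) I ` P" if Y: "primeideal Y (R Quot I)" "Y \<subseteq> (+>) I ` P" for Y
  proof -
    obtain Q where Q: "ideal Q R" "I \<subseteq> Q" "Y = (+>) I ` Q"
      using quot_ideal_obtain[OF I primeideal.axioms(1)[OF Y(1)]] .
    have "primeideal Q R" using Y(1) primeideal_quot_iff[OF I Q(1,2)] Q(3) by simp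
    moreover have "Q \<subseteq> P" using Y(2) rcos_image_subset_iff[OF I Q(1,2) P] Q(3) by simp
    ultimately show ?thesis using min Q by blast
  qed
  then show "(+>) I ` P \<in> Min_primes (R Quot I)"
    unfolding Min_primes_def using prime primeideal_quot_iff[OF I P] by blast
qed

lemma Min_primes_quot:
  assumes I: "ideal I R"
  shows "Min_primes (R Quot I) = (\<lambda>P. (+>) I ` P) ` minimal_primes_over R I"
proof -
  have "Y \<in> Min_primes (R Quot I) \<longleftrightarrow> (\<exists>P\<in>minimal_primes_over R I. Y = (+>) I ` P)" for Y
  proof
    assume Y: "Y \<in> Min_primes (R Quot I)"
    then have "primeideal Y (R Quot I)" unfolding Min_primes_def by simp
    then obtain P where P: "ideal P R" "I \<subseteq> P" "Y = (+>) I ` P"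
      using quot_ideal_obtain[OF I primeideal.axioms(1)] by blast
    then show "\<exists>P\<in>minimal_primes_over R I. Y = (+>) I ` P"
      using Y rcos_image_in_Min_primes_iff[OF I] by blast
  next
    assume "\<exists>P\<in>minimal_primes_over R I. Y = (+>) I ` P"
    then obtain P where P: "P \<in> minimal_primes_over R I" "Y = (+>) I ` P" by blast
    then have "primeideal P R" "I \<subseteq> P" unfolding minimal_primes_over_def by auto
    then show "Y \<in> Min_primes (R Quot I)"
      using P rcos_image_in_Min_primes_iff[OF I primeideal.axioms(1)] by blast
  qed
  then show ?thesis by blast
qed

end

lemma (in noetherian_local_ring) loc_max_quot:
  assumes I: "ideal I R" "I \<subseteq> m"
  shows "loc_max (R Quot I) = (+>) I ` m"
  unfolding loc_max_def
proof (rule the_equality)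
  have proper: "m \<noteq> carrier R" using one_notin_m by blast
  show "maximalideal ((+>) I ` m) (R Quot I)"
  proof (rule maximalidealI)
    show "ideal ((+>) I ` m) (R Quot I)" by (rule ring_ideal_imp_quot_ideal[OF I(1) m_ideal])
    show "carrier (R Quot I) \<noteq> (+>) I ` m"
      unfolding carrier_quot
      using rcos_image_eq_iff[OF I(1) oneideal ideal_subset_carrier[OF I(1)] m_ideal I(2)] proper by simp
    fix Y assume Y: "ideal Y (R Quot I)" "(+>) I ` m \<subseteq> Y"
    obtain J where J: "ideal J R" "I \<subseteq> J" "Y = (+>) I ` J" using quot_ideal_obtain[OF I(1) Y(1)] .
    have "m \<subseteq> J" using Y(2) rcos_image_subset_iff[OF I(1) m_ideal I(2) J(1,2)] J(3) by simp
    then have "J = m \<or> J = carrier R" using proper_ideal_subset_m[OF J(1)] by blast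
    then show "Y = (+>) I ` m \<or> Y = carrier (R Quot I)" using J(3) carrier_quot by auto
  qed
  fix Y assume Y: "maximalideal Y (R Quot I)"
  obtain J where J: "ideal J R" "I \<subseteq> J" "Y = (+>) I ` J"
    using quot_ideal_obtain[OF I(1) maximalideal.axioms(1)[OF Y]] .
  have "J \<noteq> carrier R" using maximalideal.I_notcarr[OF Y] J(3) carrier_quot by auto
  then have "(+>) I ` J \<subseteq> (+>) I ` m" using proper_ideal_subset_m[OF J(1)] by blast
  moreover have "(+>) I ` m \<subseteq> carrier (R Quot I)"
    unfolding carrier_quot using m_subset by blast
  ultimately have "(+>) I ` m = Y \<or> (+>) I ` m = carrier (R Quot I)"
    using maximalideal.I_maximal[OF Y ring_ideal_imp_quot_ideal[OF I(1) m_ideal]] J(3) by simp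
  moreover have "(+>) I ` m \<noteq> carrier (R Quot I)"
    unfolding carrier_quot
    using rcos_image_eq_iff[OF I(1) m_ideal I(2) oneideal ideal_subset_carrier[OF I(1)]] proper by simp
  ultimately show "Y = (+>) I ` m" by simp
qed

text \<open>Transfers the entropy of a quotient to \<open>R\<close>: the lengths for
  \<open>R/I\<close> and those for \<open>R\<close> become values of the same function
  \<open>ext_length\<close> and can be compared directly.\<close>

lemma (in finite_length_self_map) lam_quot:
  assumes I: "ideal I R" "I \<subseteq> m" "\<psi> ` I \<subseteq> I"
  shows "lam (R Quot I) (quot_map R I \<psi>) k = ext_length I k"
proof -
  interpret Q: ring "R Quot I" by (rule ideal.quotient_is_ring[OF I(1)])
  note Ic = ideal_subset_carrier[OF I(1)]
  note E = ext_ideal_ideal[OF Ic, of k] and self = ext_ideal_self[OF Ic, of k]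
  have img: "(quot_map R I \<psi> ^^ k) ` loc_max (R Quot I) = (+>) I ` ((\<psi> ^^ k) ` m)"
    unfolding loc_max_quot[OF I(1,2)] image_image
    using quot_map_pow_rcos[OF hom I(1,3)] m_subset by (intro image_cong) auto
  have "Idl\<^bsub>R Quot I\<^esub> ((+>) I ` ((\<psi> ^^ k) ` m)) = (+>) I ` ext_ideal I k"
  proof
    show "Idl\<^bsub>R Quot I\<^esub> ((+>) I ` ((\<psi> ^^ k) ` m)) \<subseteq> (+>) I ` ext_ideal I k"
      using self(2) by (intro Q.genideal_minimal ring_ideal_imp_quot_ideal[OF I(1) E] image_mono)
    have gens: "(+>) I ` ((\<psi> ^^ k) ` m) \<subseteq> carrier (R Quot I)"
      unfolding carrier_quot using pow_image_subset[OF m_subset] by (intro image_mono)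
    obtain J where J: "ideal J R" "I \<subseteq> J" "Idl\<^bsub>R Quot I\<^esub> ((+>) I ` ((\<psi> ^^ k) ` m)) = (+>) I ` J"
      using quot_ideal_obtain[OF I(1) Q.genideal_ideal[OF gens]] .
    have "x \<in> J" if x: "x \<in> (\<psi> ^^ k) ` m" for x
    proof -
      have "I +> x \<in> (+>) I ` J" using Q.genideal_self[OF gens] x J(3) by blast
      moreover have "x \<in> carrier R" using x pow_image_subset[OF m_subset] by blast
      ultimately show ?thesis using rcos_mem_image_iff[OF I(1) J(1,2)] by simp
    qed
    then have "ext_ideal I k \<subseteq> J" using J by (intro ext_ideal_least) auto
    then show "(+>) I ` ext_ideal I k \<subseteq> Idl\<^bsub>R Quot I\<^esub> ((+>) I ` ((\<psi> ^^ k) ` m))"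
      unfolding J(3) by (rule image_mono)
  qed
  then show ?thesis
    unfolding lam_def img ext_length_def using quot_length_quot[OF I(1) E self(1)] by simp
qed

section \<open>The entropy formula\<close>

lemma noeth_local_ring_locale:
  assumes "noeth_local_ring R"
  shows "noetherian_local_ring R (loc_max R)"
proof -
  have R: "cring R" "noetherian_ring R" and ex: "\<exists>!m. maximalideal m R"
    using assms unfolding noeth_local_ring_def by auto
  show ?thesis
    using R theI'[OF ex] ex unfolding loc_max_def
    by (intro noetherian_local_ring.intro noetherian_cring.intro noetherian_local_ring_axioms.intro) auto
qed

theorem mainTheorem17:
  fixes R :: "('a, 'b) ring_scheme" and \<phi> :: "'a \<Rightarrow> 'a" and n p :: nat
  defines "K \<equiv> a_kernel R R (\<phi> ^^ n)"
  assumes R: "noeth_local_ring R"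
    and loc: "local_self_map R \<phi>"
    and intg: "integral_self_map R \<phi>"
    and inj: "inj_on (quot_map R K \<phi>) (carrier (R Quot K))"
    and p_def: "p = (LEAST q. q \<ge> 1 \<and>
                  (\<forall>Q \<in> Min_primes (R Quot K). (spec_map (R Quot K) (quot_map R K \<phi>) ^^ q) Q = Q))"
  shows "(\<forall>P. primeideal P R \<and> K \<subseteq> P \<and> quot_ideal R K P \<in> Min_primes (R Quot K)
              \<longrightarrow> Idl\<^bsub>R\<^esub> ((\<phi> ^^ p) ` P) \<subseteq> P)
       \<and> h_alg R \<phi> = (1 / real p) * Max {h_alg (R Quot P) (quot_map R P (\<phi> ^^ p)) | P.
              primeideal P R \<and> K \<subseteq> P \<and> quot_ideal R K P \<in> Min_primes (R Quot K)}"
proof -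
  define m where "m = loc_max R"
  interpret noetherian_local_ring R m
    unfolding m_def by (rule noeth_local_ring_locale[OF R])
  have hom: "\<phi> \<in> ring_hom R R" and "\<phi> ` m \<subseteq> m"
    using loc unfolding local_self_map_def m_def by auto
  then interpret phi: finite_length_self_map R m \<phi>
    using finite_length_over_image_of_m[OF hom intg] by unfold_locales
  interpret hom: ring_hom_ring R R \<phi>
    using hom by (intro ring_hom_ringI2 ring_axioms)
  interpret homn: ring_hom_ring R R "\<phi> ^^ n"
    using phi.pow_hom by (intro ring_hom_ringI2 ring_axioms)

  have K: "ideal K R" unfolding K_def by (rule homn.kernel_is_ideal)
  have K_iff: "x \<in> K \<longleftrightarrow> x \<in> carrier R \<and> (\<phi> ^^ n) x = \<zero>\<^bsub>R\<^esub>" for x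
    unfolding K_def a_kernel_def' by simp
  have stable: "\<phi> ` K \<subseteq> K"
  proof (rule image_subsetI)
    fix x assume x: "x \<in> K"
    then have "(\<phi> ^^ n) (\<phi> x) = \<phi> ((\<phi> ^^ n) x)" by (simp add: funpow_swap1)
    then show "\<phi> x \<in> K" using x unfolding K_iff by simp
  qed
  \<comment> \<open>Injectivity of the induced map, applied to the cosets of \<open>x\<close> and
    zero, becomes a statement about elements of \<open>R\<close>.\<close>
  have contr: "\<phi> x \<in> K \<longleftrightarrow> x \<in> K" if x: "x \<in> carrier R" for x
  proof
    assume fx: "\<phi> x \<in> K"
    have "K +>\<^bsub>R\<^esub> \<phi> x = K +>\<^bsub>R\<^esub> \<zero>\<^bsub>R\<^esub>"
      using quotient_eq_iff_same_a_r_cos[OF K, of "\<phi> x" "\<zero>\<^bsub>R\<^esub>"] x fx by (simp add: minus_eq)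
    then have "quot_map R K \<phi> (K +>\<^bsub>R\<^esub> x) = quot_map R K \<phi> (K +>\<^bsub>R\<^esub> \<zero>\<^bsub>R\<^esub>)"
      using quot_map_rcos[OF hom K stable x] quot_map_rcos[OF hom K stable zero_closed] by simp
    then have "K +>\<^bsub>R\<^esub> x = K +>\<^bsub>R\<^esub> \<zero>\<^bsub>R\<^esub>"
      by (rule inj_onD[OF inj]) (use x carrier_quot in auto)
    then show "x \<in> K"
      using quotient_eq_iff_same_a_r_cos[OF K, of x "\<zero>\<^bsub>R\<^esub>"] x by (simp add: minus_eq)
  qed (use stable in blast)

  define M where "M = minimal_primes_over R K"
  define F where "F P = {x \<in> carrier R. \<phi> x \<in> P}" for P
  have M_primes: "primeideal P R" "K \<subseteq> P" "ideal P R" if "P \<in> M" for P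
    using that primeideal.axioms(1) unfolding M_def minimal_primes_over_def by auto
  have M_iff: "primeideal P R \<and> K \<subseteq> P \<and> quot_ideal R K P \<in> Min_primes (R Quot K) \<longleftrightarrow> P \<in> M" for P
    using rcos_image_in_Min_primes_iff[OF K, of P] primeideal.axioms(1)[of P R] M_primes[of P]
    unfolding quot_ideal_def M_def by blast
  have M_fin: "finite M" unfolding M_def by (rule finite_minimal_primes_over[OF K])
  \<comment> \<open>\<open>\<phi>^n\<close> fixes 1, so \<open>K\<close> is proper and
    \<open>m\<close> is a prime over it. Hence a minimal prime exists and the maximum ranges over a
    nonempty set.\<close>
  have "m \<in> {P. primeideal P R \<and> K \<subseteq> P}"
  proof -
    have "(\<phi> ^^ n) \<one>\<^bsub>R\<^esub> \<noteq> \<zero>\<^bsub>R\<^esub>"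
      using one_notin_m additive_subgroup.zero_closed[OF ideal.axioms(1)[OF m_ideal]] by force
    then have "K \<noteq> carrier R" using K_iff by blast
    then show ?thesis using maximalideal_prime[OF maximal] proper_ideal_subset_m[OF K] by simp
  qed
  then have M_ne: "M \<noteq> {}" unfolding M_def using minimal_prime_below[OF K, of m] by auto

  have F_pow: "(F ^^ q) P = {x \<in> carrier R. (\<phi> ^^ q) x \<in> P}" if "ideal P R" for q P
  proof (induction q)
    case 0
    then show ?case using ideal_subset_carrier[OF that] by auto
  next
    case (Suc q)
    have "(F ^^ Suc q) P = F {x \<in> carrier R. (\<phi> ^^ q) x \<in> P}" by (simp add: Suc)
    also have "\<dots> = {x \<in> carrier R. (\<phi> ^^ Suc q) x \<in> P}"
      unfolding F_def using ring_hom_closed[OF hom] by (auto simp: funpow_swap1)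
    finally show ?case .
  qed
  \<comment> \<open>The condition that defines \<open>p\<close> is moved from the cosets in
    \<open>Min_primes (R Quot K)\<close> to the ideals in \<open>M\<close>. Only the existence of
    some such exponent makes the \<open>LEAST\<close> meaningful.\<close>
  define fixes_M where "fixes_M q \<longleftrightarrow> q \<ge> 1 \<and> (\<forall>P\<in>M. (F ^^ q) P = P)" for q
  have "q \<ge> 1 \<and> (\<forall>Q \<in> Min_primes (R Quot K). (spec_map (R Quot K) (quot_map R K \<phi>) ^^ q) Q = Q)
      \<longleftrightarrow> fixes_M q" for q
  proof -
    have "(spec_map (R Quot K) (quot_map R K \<phi>) ^^ q) ((+>\<^bsub>R\<^esub>) K ` P) = (+>\<^bsub>R\<^esub>) K ` P
        \<longleftrightarrow> (F ^^ q) P = P" if P: "P \<in> M" for P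
    proof -
      interpret homq: ring_hom_ring R R "\<phi> ^^ q"
        using phi.pow_hom by (intro ring_hom_ringI2 ring_axioms)
      note Pi = M_primes(3)[OF P] and KP = M_primes(2)[OF P]
      have "ideal {x \<in> carrier R. (\<phi> ^^ q) x \<in> P} R" by (rule homq.ideal_vimage[OF Pi])
      moreover have "K \<subseteq> {x \<in> carrier R. (\<phi> ^^ q) x \<in> P}"
        using funpow_image_subset[OF stable, of q] KP ideal_subset_carrier[OF K] by blast
      ultimately show ?thesis
        unfolding spec_map_pow_quot[OF hom K stable Pi KP] F_pow[OF Pi]
        by (rule rcos_image_eq_iff[OF K _ _ Pi KP])
    qed
    then show ?thesis
      unfolding fixes_M_def Min_primes_quot[OF K] M_def[symmetric] by auto
  qed
  then have p_Least: "p = (LEAST q. fixes_M q)" using p_def by simp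
  have "\<exists>q. fixes_M q"
  proof -
    have "F ` M = M"
      using contraction_permutes_minimal_primes[OF hom K contr] unfolding M_def F_def .
    then show ?thesis
      unfolding fixes_M_def using finite_surj_power_identity[OF M_fin, of F] by blast
  qed
  then have "fixes_M p" unfolding p_Least by (rule LeastI_ex)
  then have p1: "p \<ge> 1" and p_fix: "\<And>P. P \<in> M \<Longrightarrow> (F ^^ p) P = P"
    unfolding fixes_M_def by auto
  have p_stable: "(\<phi> ^^ p) ` P \<subseteq> P" if "P \<in> M" for P
    using p_fix[OF that] F_pow[OF M_primes(3)[OF that], of p] by blast

  interpret psi: finite_length_self_map R m "\<phi> ^^ p"
    by (rule finite_length_self_map_pow) unfold_locales
  \<comment> \<open>\<open>\<lambda>(\<psi>^k) = \<lambda>(\<phi>^(pk))\<close>, so this is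
    \<open>p\<close> times the subsequence along the multiples of \<open>p\<close>; it converges
    since the full sequence for \<open>\<phi>\<close> does.\<close>
  have h_R: "(\<lambda>k. ln (real (psi.ext_length {} k)) / real k) \<longlonglongrightarrow> real p * h_alg R \<phi>"
  proof -
    have "(\<lambda>k. ln (real (lam R \<phi> k)) / real k) \<longlonglongrightarrow> h_alg R \<phi>"
      unfolding h_alg_def phi.lam_eq_ext_length by (rule phi.ext_length_growth_limit) auto
    moreover have "strict_mono (\<lambda>k. p * k)" using p1 by (intro strict_monoI) simp
    ultimately have "((\<lambda>k. ln (real (lam R \<phi> k)) / real k) \<circ> (\<lambda>k. p * k)) \<longlonglongrightarrow> h_alg R \<phi>"
      by (rule LIMSEQ_subseq_LIMSEQ)
    then have "(\<lambda>k. real p * (ln (real (lam R \<phi> (p * k))) / real (p * k))) \<longlonglongrightarrow> real p * h_alg R \<phi>"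
      by (intro tendsto_mult tendsto_const) (simp add: comp_def)
    moreover have "real p * (ln (real (lam R \<phi> (p * k))) / real (p * k))
        = ln (real (psi.ext_length {} k)) / real k" for k
    proof -
      have "lam R \<phi> (p * k) = psi.ext_length {} k"
        unfolding psi.lam_eq_ext_length[symmetric] lam_def by (simp add: funpow_mult)
      then show ?thesis using p1 by simp
    qed
    ultimately show ?thesis by simp
  qed
  define H where "H P = h_alg (R Quot P) (quot_map R P (\<phi> ^^ p))" for P
  have M_m: "P \<subseteq> m" if "P \<in> M" for P
    using that unfolding M_def by (rule psi.minimal_prime_subset_m)
  have H: "(\<lambda>k. ln (real (psi.ext_length P k)) / real k) \<longlonglongrightarrow> H P" if P: "P \<in> M" for P
    unfolding H_def h_alg_def psi.lam_quot[OF M_primes(3)[OF P] M_m[OF P] p_stable[OF P]]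
    by (rule psi.ext_length_growth_limit[OF M_m[OF P] p_stable[OF P]])
  \<comment> \<open>As \<open>p \<ge> 1\<close>, the exponent \<open>p * n\<close> is at least
    \<open>n\<close>, so this power factors through \<open>\<phi>^n\<close> and annihilates
    \<open>K\<close>.\<close>
  have "((\<phi> ^^ p) ^^ n) x = \<zero>\<^bsub>R\<^esub>" if x: "x \<in> K" for x
  proof -
    have "(\<phi> ^^ (p * n)) x = (\<phi> ^^ (p * n - n)) ((\<phi> ^^ n) x)"
      using p1 by (simp add: funpow_add[THEN fun_cong, unfolded comp_apply, symmetric])
    also have "\<dots> = \<zero>\<^bsub>R\<^esub>"
    proof -
      interpret homj: ring_hom_ring R R "\<phi> ^^ (p * n - n)"
        using phi.pow_hom by (intro ring_hom_ringI2 ring_axioms)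
      show ?thesis using x unfolding K_iff by simp
    qed
    finally show ?thesis by (simp add: funpow_mult)
  qed
  then obtain C where C: "\<And>k. psi.ext_length {} (n + k) \<le> C * (\<Sum>P\<in>M. psi.ext_length P k)"
    using psi.ext_length_le_sum_minimal_primes[OF K, of n] unfolding M_def by blast
  \<comment> \<open>One estimate is monotonicity from \<open>{}\<close> to \<open>P\<close>, the
    other is the bound with the constant \<open>C\<close>; every term is at least 1 because
    \<open>P\<close> lies in \<open>m\<close>.\<close>
  have "real p * h_alg R \<phi> = Max (H ` M)"
    using psi.ext_length_ge_1[OF M_m] ideal_subset_carrier[OF M_primes(3)]
    by (intro growth_limit_eq_Max[OF M_fin M_ne _ _ C h_R H] psi.ext_length_antimono) auto
  moreover have "{h_alg (R Quot P) (quot_map R P (\<phi> ^^ p)) | P.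
      primeideal P R \<and> K \<subseteq> P \<and> quot_ideal R K P \<in> Min_primes (R Quot K)} = H ` M"
    unfolding M_iff H_def by blast
  ultimately have "h_alg R \<phi> = (1 / real p) * Max {h_alg (R Quot P) (quot_map R P (\<phi> ^^ p)) | P.
      primeideal P R \<and> K \<subseteq> P \<and> quot_ideal R K P \<in> Min_primes (R Quot K)}"
    using p1 by (simp add: field_simps)
  moreover have "Idl\<^bsub>R\<^esub> ((\<phi> ^^ p) ` P) \<subseteq> P" if "P \<in> M" for P
    by (rule genideal_minimal[OF M_primes(3)[OF that] p_stable[OF that]])
  ultimately show ?thesis unfolding M_iff by blast
qed

end
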